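(* Let $(M,\varphi)$ be a connected, compact, orientable Riemannian manifold of dimension $m$ and $(N,\psi)$ a Riemannian manifold of dimension $n$. Let $T$ be a tensor of type $(1,1)$ on $M\times N$ all of whose components vanish except $T^i_\alpha(a,x)$, $i=1,\dots,n$, $\alpha=1,\dots,m$. If $f\in C^\infty(M,N)$ is a solution of the system of partial differential equations $$\delta f=T,\qquad\text{expressed locally by}\qquad \frac{\partial f^i}{\partial a^\alpha}(a)=T^i_\alpha(a,f(a)),$$ then $f$ is a solution of the variational problem associated to the functional $$\mathcal L_T: C^\infty(M,N)\setminus\{f \mid \exists\, a\in M \text{ such that } \langle\delta f,T\rangle(a)=0\}\to\mathbb R_+,$$ $$\mathcal L_T(f)=\frac12\int_M\frac{\|\delta f\|^2\,\|T\|^2}{\langle\delta f,T\rangle^2}\sqrt{\varphi}\,da=\frac12\int_M\frac{\|T\|^2}{\langle\delta f,T\rangle^2}\,\varphi^{\alpha\beta}\psi_{ij}\,f^i_\alpha f^j_\beta\,\sqrt{\varphi}\,da.$$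
   Context: The summation convention is used; $(a^\alpha)$ are local coordinates on $M$ and $(x^i)$ on $N$, $f^i=x^i\circ f$, $f^i_\alpha=\frac{\partial f^i}{\partial a^\alpha}$, $\varphi^{\alpha\beta}$ is the inverse of $\varphi_{\alpha\beta}$, and $\sqrt\varphi\,da$, with $\varphi=\det(\varphi_{\alpha\beta})$, is the Riemannian volume element of $(M,\varphi)$. For $f\in C^\infty(M,N)$, $\delta f\in\Gamma(T^*M\otimes f^{-1}(TN))$ denotes the differential of $f$ regarded as a section, with components $f^i_\alpha$. Along $f$, the tensor $T$ is likewise regarded as the section of $T^*M\otimes f^{-1}(TN)$ with components $T^i_\alpha(a,f(a))$. For sections $T,S\in\Gamma(T^*M\otimes f^{-1}(TN))$ the scalar product is the function on $M$ $$\langle T,S\rangle(a)=\varphi^{\alpha\beta}(a)\,\psi_{ij}(f(a))\,T^i_\alpha S^j_\beta,\qquad \|T\|^2=\langle T,T\rangle .$$ A solution of the variational problem associated to a functional means a critical point (extremal) of that functional.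
   Formalization: The formal theorem assumes in addition that ⟨δf,T⟩ vanishes nowhere on M, i.e. that f lies in the domain of L_T; otherwise (e.g. T = 0 and f constant) L_T(f) is undefined. *)

theory Defs
  imports "HOL-Analysis.Analysis"
begin

section \<open>Smooth maps between Euclidean spaces\<close>

text \<open>These notions are only used on open sets, where \<^term>\<open>frechet_derivative f (at x)\<close> is the
  total derivative.\<close>

primrec Ck_on :: "nat \<Rightarrow> ('a::euclidean_space) set \<Rightarrow> ('a \<Rightarrow> 'b::real_normed_vector) \<Rightarrow> bool" where
  "Ck_on 0 S f \<longleftrightarrow> continuous_on S f"
| "Ck_on (Suc k) S f \<longleftrightarrow>
     (\<forall>x\<in>S. f differentiable (at x)) \<and> (\<forall>v. Ck_on k S (\<lambda>x. frechet_derivative f (at x) v))"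

definition smooth_on :: "('a::euclidean_space) set \<Rightarrow> ('a \<Rightarrow> 'b::real_normed_vector) \<Rightarrow> bool" where
  "smooth_on S f \<longleftrightarrow> (\<forall>k. Ck_on k S f)"


section \<open>Smooth manifolds\<close>

text \<open>A manifold is a whole type (Hausdorff and second countable, by its type class) together with
  a smooth atlas; the atlas need not be maximal. A chart is a domain paired with a coordinate map,
  whose values outside the domain are irrelevant. The dimension is the cardinality of the index
  type of the coordinates.\<close>

type_synonym ('p, 'm) chart = "'p set \<times> ('p \<Rightarrow> real ^ 'm)"

abbreviation chart_dom :: "('p, 'm::finite) chart \<Rightarrow> 'p set" where
  "chart_dom c \<equiv> fst c"

abbreviation coords :: "('p, 'm::finite) chart \<Rightarrow> 'p \<Rightarrow> real ^ 'm" where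
  "coords c \<equiv> snd c"

definition chart_inv :: "('p, 'm::finite) chart \<Rightarrow> real ^ 'm \<Rightarrow> 'p" where
  "chart_inv c = inv_into (chart_dom c) (coords c)"

definition is_chart :: "('p::topological_space, 'm::finite) chart \<Rightarrow> bool" where
  "is_chart c \<longleftrightarrow> open (chart_dom c) \<and> open (coords c ` chart_dom c) \<and>
     homeomorphism (chart_dom c) (coords c ` chart_dom c) (coords c) (chart_inv c)"

definition smooth_atlas :: "('p::topological_space, 'm::finite) chart set \<Rightarrow> bool" where
  "smooth_atlas A \<longleftrightarrow> (\<forall>c\<in>A. is_chart c) \<and> (\<Union>c\<in>A. chart_dom c) = UNIV \<and>
     (\<forall>c\<in>A. \<forall>d\<in>A. smooth_on (coords c ` (chart_dom c \<inter> chart_dom d)) (coords d \<circ> chart_inv c))"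

text \<open>The matrix of partial derivatives of the components of \<open>f\<close> in the charts \<open>c\<close> (source) and
  \<open>d\<close> (target): the entry \<open>jacobian_in c d f p $ i $ \<alpha>\<close> is $f^i_\alpha(p)$.\<close>

definition jacobian_in ::
  "('p, 'm::finite) chart \<Rightarrow> ('q, 'n::finite) chart \<Rightarrow> ('p \<Rightarrow> 'q) \<Rightarrow> 'p \<Rightarrow> real ^ 'm ^ 'n" where
  "jacobian_in c d f p = matrix (frechet_derivative (coords d \<circ> f \<circ> chart_inv c) (at (coords c p)))"

abbreviation transition_jacobian ::
  "('p, 'm::finite) chart \<Rightarrow> ('p, 'm) chart \<Rightarrow> 'p \<Rightarrow> real ^ 'm ^ 'm" where
  "transition_jacobian c d \<equiv> jacobian_in c d id"

definition orientable :: "('p::topological_space, 'm::finite) chart set \<Rightarrow> bool" where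
  "orientable A \<longleftrightarrow> (\<exists>A'. smooth_atlas A' \<and> smooth_atlas (A \<union> A') \<and>
     (\<forall>c\<in>A'. \<forall>d\<in>A'. \<forall>p\<in>chart_dom c \<inter> chart_dom d. det (transition_jacobian c d p) > 0))"

definition smooth_maps ::
  "('p::topological_space, 'm::finite) chart set \<Rightarrow> ('q::topological_space, 'n::finite) chart set
    \<Rightarrow> ('p \<Rightarrow> 'q) set" where
  "smooth_maps A B = {f. continuous_on UNIV f \<and>
     (\<forall>c\<in>A. \<forall>d\<in>B. smooth_on (coords c ` (chart_dom c \<inter> f -` chart_dom d)) (coords d \<circ> f \<circ> chart_inv c))}"

definition product_chart ::
  "('p, 'm::finite) chart \<Rightarrow> ('q, 'n::finite) chart \<Rightarrow> ('p \<times> 'q, 'm + 'n) chart" where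
  "product_chart c d = (chart_dom c \<times> chart_dom d,
     \<lambda>(p, q). \<chi> k. case k of Inl \<alpha> \<Rightarrow> coords c p $ \<alpha> | Inr i \<Rightarrow> coords d q $ i)"

definition product_atlas ::
  "('p, 'm::finite) chart set \<Rightarrow> ('q, 'n::finite) chart set \<Rightarrow> ('p \<times> 'q, 'm + 'n) chart set" where
  "product_atlas A B = {product_chart c d | c d. c \<in> A \<and> d \<in> B}"


section \<open>Tensors and Riemannian metrics\<close>

text \<open>Tensor fields are given classically, by smooth components in every chart of the atlas, subject
  to the transformation law. For a tensor of type (1,1) the row index is the contravariant one.\<close>

definition tensor_field_11 ::
  "('p::topological_space, 'm::finite) chart set \<Rightarrow> (('p, 'm) chart \<Rightarrow> 'p \<Rightarrow> real ^ 'm ^ 'm) \<Rightarrow> bool"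
where
  "tensor_field_11 A T \<longleftrightarrow>
     (\<forall>c\<in>A. smooth_on (coords c ` chart_dom c) (T c \<circ> chart_inv c)) \<and>
     (\<forall>c\<in>A. \<forall>d\<in>A. \<forall>p\<in>chart_dom c \<inter> chart_dom d.
        T d p = transition_jacobian c d p ** T c p ** transition_jacobian d c p)"

definition riemannian_metric ::
  "('p::topological_space, 'm::finite) chart set \<Rightarrow> (('p, 'm) chart \<Rightarrow> 'p \<Rightarrow> real ^ 'm ^ 'm) \<Rightarrow> bool"
where
  "riemannian_metric A g \<longleftrightarrow>
     (\<forall>c\<in>A. smooth_on (coords c ` chart_dom c) (g c \<circ> chart_inv c)) \<and>
     (\<forall>c\<in>A. \<forall>p\<in>chart_dom c. transpose (g c p) = g c p \<and> (\<forall>v. v \<noteq> 0 \<longrightarrow> v \<bullet> (g c p *v v) > 0)) \<and>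
     (\<forall>c\<in>A. \<forall>d\<in>A. \<forall>p\<in>chart_dom c \<inter> chart_dom d.
        g d p = transpose (transition_jacobian d c p) ** g c p ** transition_jacobian d c p)"

definition riemannian_manifold ::
  "('p::{t2_space, second_countable_topology}, 'm::finite) chart set
    \<Rightarrow> (('p, 'm) chart \<Rightarrow> 'p \<Rightarrow> real ^ 'm ^ 'm) \<Rightarrow> bool" where
  "riemannian_manifold A g \<longleftrightarrow> smooth_atlas A \<and> riemannian_metric A g"

text \<open>The Riemannian volume measure: split the manifold into countably many disjoint Borel pieces,
  each inside the domain of a chart, and integrate $\sqrt{\det g}$ in the coordinates of each piece.
  A covering sequence of charts exists by second countability, and the measure does not depend on
  the choice, by the change of variables formula.\<close>

definition chart_cover :: "('p, 'm::finite) chart set \<Rightarrow> nat \<Rightarrow> ('p, 'm) chart" where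
  "chart_cover A = (SOME c. range c \<subseteq> A \<and> (\<Union>k. chart_dom (c k)) = UNIV)"

definition riemannian_volume ::
  "('p::{t2_space, second_countable_topology}, 'm::finite) chart set
    \<Rightarrow> (('p, 'm) chart \<Rightarrow> 'p \<Rightarrow> real ^ 'm ^ 'm) \<Rightarrow> 'p measure" where
  "riemannian_volume A g = measure_of UNIV (sets borel)
     (\<lambda>E. \<Sum>k. let c = chart_cover A k; D = disjointed (\<lambda>j. chart_dom (chart_cover A j)) k in
        (\<integral>\<^sup>+u\<in>coords c ` (E \<inter> D). ennreal (sqrt (det (g c (chart_inv c u)))) \<partial>lborel))"

lemma chart_cover_exists:
  fixes A :: "('p::{t2_space, second_countable_topology}, 'm::finite) chart set"
  assumes "smooth_atlas A"
  shows "range (chart_cover A) \<subseteq> A \<and> (\<Union>k. chart_dom (chart_cover A k)) = UNIV"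
proof -
  have op: "\<And>S. S \<in> chart_dom ` A \<Longrightarrow> open S" and cov: "\<Union>(chart_dom ` A) = UNIV"
    using assms by (auto simp: smooth_atlas_def is_chart_def)
  obtain F where F: "F \<subseteq> chart_dom ` A" "countable F" "\<Union>F = \<Union>(chart_dom ` A)"
    using Lindelof[of "chart_dom ` A"] op by blast
  obtain A0 where A0: "countable A0" "A0 \<subseteq> A" "F = chart_dom ` A0"
    using F countable_subset_image by metis
  have "A0 \<noteq> {}" using A0 F cov by auto
  then have r: "range (from_nat_into A0) = A0"
    using A0 by (simp add: range_from_nat_into)
  have "(\<Union>k. chart_dom (from_nat_into A0 k)) = \<Union>(chart_dom ` range (from_nat_into A0))"
    by (simp only: image_image)
  also have "\<dots> = UNIV"
    unfolding r using A0(3) F(3) cov by simp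
  finally have "\<exists>c. range c \<subseteq> A \<and> (\<Union>k::nat. chart_dom (c k)) = UNIV"
    using r A0(2) by (intro exI[of _ "from_nat_into A0"]) (rule conjI, simp_all only:)
  then show ?thesis
    unfolding chart_cover_def by (rule someI_ex)
qed


section \<open>Sections of $T^*M \otimes f^{-1}(TN)$\<close>

text \<open>Such a section is given by its components $S^i_\alpha$ in a chart of \<open>M\<close> and a chart of \<open>N\<close>;
  the row index is \<open>i\<close>. The scalar product is evaluated in arbitrarily chosen charts around
  \<open>a\<close> and \<open>f a\<close>, its value being independent of this choice.\<close>

type_synonym ('p, 'm, 'q, 'n) mixed_section =
  "('p, 'm) chart \<Rightarrow> ('q, 'n) chart \<Rightarrow> 'p \<Rightarrow> real ^ 'm ^ 'n"

definition differential_section ::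
  "('p \<Rightarrow> 'q) \<Rightarrow> ('p, 'm::finite, 'q, 'n::finite) mixed_section" where
  "differential_section f c d a = jacobian_in c d f a"

definition tensor_along ::
  "(('p \<times> 'q, 'm + 'n) chart \<Rightarrow> 'p \<times> 'q \<Rightarrow> real ^ ('m + 'n) ^ ('m + 'n)) \<Rightarrow> ('p \<Rightarrow> 'q)
    \<Rightarrow> ('p, 'm::finite, 'q, 'n::finite) mixed_section" where
  "tensor_along T f c d a = (\<chi> i \<alpha>. T (product_chart c d) (a, f a) $ Inr i $ Inl \<alpha>)"

definition chart_at :: "('p, 'm::finite) chart set \<Rightarrow> 'p \<Rightarrow> ('p, 'm) chart" where
  "chart_at A a = (SOME c. c \<in> A \<and> a \<in> chart_dom c)"

definition section_inner ::
  "('p, 'm::finite) chart set \<Rightarrow> (('p, 'm) chart \<Rightarrow> 'p \<Rightarrow> real ^ 'm ^ 'm)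
    \<Rightarrow> ('q, 'n::finite) chart set \<Rightarrow> (('q, 'n) chart \<Rightarrow> 'q \<Rightarrow> real ^ 'n ^ 'n)
    \<Rightarrow> ('p \<Rightarrow> 'q) \<Rightarrow> ('p, 'm, 'q, 'n) mixed_section \<Rightarrow> ('p, 'm, 'q, 'n) mixed_section \<Rightarrow> 'p \<Rightarrow> real"
where
  "section_inner A \<phi> B \<psi> f S S' a =
     (let c = chart_at A a; d = chart_at B (f a) in
        \<Sum>\<alpha>\<in>UNIV. \<Sum>\<beta>\<in>UNIV. \<Sum>i\<in>UNIV. \<Sum>j\<in>UNIV.
          matrix_inv (\<phi> c a) $ \<alpha> $ \<beta> * \<psi> d (f a) $ i $ j * S c d a $ i $ \<alpha> * S' c d a $ j $ \<beta>)"

definition only_mixed_components ::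
  "('p, 'm::finite) chart set \<Rightarrow> ('q, 'n::finite) chart set
    \<Rightarrow> (('p \<times> 'q, 'm + 'n) chart \<Rightarrow> 'p \<times> 'q \<Rightarrow> real ^ ('m + 'n) ^ ('m + 'n)) \<Rightarrow> bool" where
  "only_mixed_components A B T \<longleftrightarrow>
     (\<forall>c\<in>A. \<forall>d\<in>B. \<forall>p\<in>chart_dom c. \<forall>q\<in>chart_dom d. \<forall>I J.
        T (product_chart c d) (p, q) $ I $ J \<noteq> 0 \<longrightarrow> (\<exists>i \<alpha>. I = Inr i \<and> J = Inl \<alpha>))"

definition solves_pde ::
  "('p, 'm::finite) chart set \<Rightarrow> ('q, 'n::finite) chart set
    \<Rightarrow> (('p \<times> 'q, 'm + 'n) chart \<Rightarrow> 'p \<times> 'q \<Rightarrow> real ^ ('m + 'n) ^ ('m + 'n)) \<Rightarrow> ('p \<Rightarrow> 'q) \<Rightarrow> bool" where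
  "solves_pde A B T f \<longleftrightarrow>
     (\<forall>c\<in>A. \<forall>d\<in>B. \<forall>a\<in>chart_dom c. f a \<in> chart_dom d \<longrightarrow>
        differential_section f c d a = tensor_along T f c d a)"


section \<open>The functional and its extremals\<close>

definition functional_domain ::
  "('p::topological_space, 'm::finite) chart set \<Rightarrow> (('p, 'm) chart \<Rightarrow> 'p \<Rightarrow> real ^ 'm ^ 'm)
    \<Rightarrow> ('q::topological_space, 'n::finite) chart set \<Rightarrow> (('q, 'n) chart \<Rightarrow> 'q \<Rightarrow> real ^ 'n ^ 'n)
    \<Rightarrow> (('p \<times> 'q, 'm + 'n) chart \<Rightarrow> 'p \<times> 'q \<Rightarrow> real ^ ('m + 'n) ^ ('m + 'n)) \<Rightarrow> ('p \<Rightarrow> 'q) set" where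
  "functional_domain A \<phi> B \<psi> T = smooth_maps A B -
     {f. \<exists>a. section_inner A \<phi> B \<psi> f (differential_section f) (tensor_along T f) a = 0}"

definition functional_L ::
  "('p::{t2_space, second_countable_topology}, 'm::finite) chart set
    \<Rightarrow> (('p, 'm) chart \<Rightarrow> 'p \<Rightarrow> real ^ 'm ^ 'm)
    \<Rightarrow> ('q, 'n::finite) chart set \<Rightarrow> (('q, 'n) chart \<Rightarrow> 'q \<Rightarrow> real ^ 'n ^ 'n)
    \<Rightarrow> (('p \<times> 'q, 'm + 'n) chart \<Rightarrow> 'p \<times> 'q \<Rightarrow> real ^ ('m + 'n) ^ ('m + 'n)) \<Rightarrow> ('p \<Rightarrow> 'q) \<Rightarrow> real" where
  "functional_L A \<phi> B \<psi> T f =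
     (let ip = section_inner A \<phi> B \<psi> f; \<delta>f = differential_section f; Tf = tensor_along T f in
        1 / 2 * (\<integral>a. ip \<delta>f \<delta>f a * ip Tf Tf a / (ip \<delta>f Tf a)\<^sup>2 \<partial>riemannian_volume A \<phi>))"

text \<open>A smooth variation of \<open>f\<close> is a smooth map $(-\varepsilon,\varepsilon) \times M \to N$ that
  restricts to \<open>f\<close> at time 0.\<close>

definition smooth_variation ::
  "('p::topological_space, 'm::finite) chart set \<Rightarrow> ('q::topological_space, 'n::finite) chart set
    \<Rightarrow> ('p \<Rightarrow> 'q) \<Rightarrow> real \<Rightarrow> (real \<Rightarrow> 'p \<Rightarrow> 'q) \<Rightarrow> bool" where
  "smooth_variation A B f \<epsilon> F \<longleftrightarrow> \<epsilon> > 0 \<and> F 0 = f \<and>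
     continuous_on ({-\<epsilon><..<\<epsilon>} \<times> UNIV) (\<lambda>(t, p). F t p) \<and>
     (\<forall>c\<in>A. \<forall>d\<in>B.
        smooth_on {(t, coords c p) | t p. t \<in> {-\<epsilon><..<\<epsilon>} \<and> p \<in> chart_dom c \<and> F t p \<in> chart_dom d}
          (\<lambda>(t, u). coords d (F t (chart_inv c u))))"

text \<open>A critical point (extremal) of a functional \<open>L\<close> defined on a set \<open>D\<close> of smooth maps: the first
  variation exists and vanishes along every smooth variation within \<open>D\<close>.\<close>

definition critical_point ::
  "('p::topological_space, 'm::finite) chart set \<Rightarrow> ('q::topological_space, 'n::finite) chart set
    \<Rightarrow> ('p \<Rightarrow> 'q) set \<Rightarrow> (('p \<Rightarrow> 'q) \<Rightarrow> real) \<Rightarrow> ('p \<Rightarrow> 'q) \<Rightarrow> bool" where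
  "critical_point A B D L f \<longleftrightarrow> f \<in> D \<and>
     (\<forall>\<epsilon> F. smooth_variation A B f \<epsilon> F \<and> (\<forall>t\<in>{-\<epsilon><..<\<epsilon>}. F t \<in> D) \<longrightarrow>
        ((\<lambda>t. L (F t)) has_real_derivative 0) (at 0))"

end

theory Submission
  imports Defs "HOL-Library.Landau_Symbols"
begin

text \<open>
  Let $R = \delta f - T$ be the failure of a map \<open>f\<close> to solve $\delta f = T$. By the Cauchy-Schwarz
  inequality the integrand $\|\delta f\|^2 \|T\|^2 / \langle\delta f,T\rangle^2$ is at least \<open>1\<close>, and it equals
  \<open>1\<close> where $R = 0$: a solution minimises the functional. What is used is a quantitative form
  of this. The Cauchy-Schwarz defect is a Gram determinant, which does not change when
  $\delta f$ is replaced by \<open>R\<close>, so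
  $$\frac{\|\delta f\|^2 \|T\|^2}{\langle\delta f,T\rangle^2} - 1
    = \frac{\|R\|^2 \|T\|^2 - \langle R,T\rangle^2}{\langle\delta f,T\rangle^2}$$
  is quadratic in \<open>R\<close> (\<open>cauchy_schwarz_defect\<close>). Along a smooth variation of a solution, \<open>R\<close> is smooth
  and vanishes at time \<open>0\<close>, so it is $O(t)$ (\<open>discrepancy_bigo\<close>) and the integrand differs from \<open>1\<close>
  by $O(t^2)$ (\<open>integrand_in_bigo\<close>), uniformly on the compact manifold
  (\<open>integrand_uniform_bound\<close>). Thus the functional changes by $O(t^2)$ and its derivative at time
  \<open>0\<close> exists and is \<open>0\<close> (\<open>integral_stationary\<close>).

  These estimates take place in charts, whereas the integrand is defined pointwise through
  arbitrarily selected charts. The bridge is the invariance of the scalar product under changes of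
  charts (\<open>section_inner_in_charts\<close>), which rests on the transformation laws of $\delta f$ and of
  \<open>T\<close> along \<open>f\<close>. It also shows that the integrand is continuous at each time, hence measurable;
  this matters since the integral of a function that is not measurable is \<open>0\<close> by
  convention.
\<close>

section \<open>Smooth functions\<close>

lemma smooth_on_continuous_on: "smooth_on S f \<Longrightarrow> continuous_on S f"
  unfolding smooth_on_def using Ck_on.simps(1) by blast

lemma smooth_on_differentiable: "smooth_on S f \<Longrightarrow> x \<in> S \<Longrightarrow> f differentiable (at x)"
  unfolding smooth_on_def using Ck_on.simps(2) by blast

lemma smooth_on_has_derivative:
  "smooth_on S f \<Longrightarrow> x \<in> S \<Longrightarrow> (f has_derivative frechet_derivative f (at x)) (at x)"
  using smooth_on_differentiable frechet_derivative_works by blast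

lemma smooth_on_frechet_derivative:
  "smooth_on S f \<Longrightarrow> smooth_on S (\<lambda>x. frechet_derivative f (at x) v)"
  unfolding smooth_on_def using Ck_on.simps(2) by blast

lemma isCont_tendsto_nhds: "isCont f x \<Longrightarrow> (f \<longlongrightarrow> f x) (nhds x)"
  unfolding isCont_def by (simp add: tendsto_at_iff_tendsto_nhds)

text \<open>The directional derivatives along the finitely many basis vectors are continuous, hence bounded
  near \<open>x\<close>; their bounds add up to a bound for the operator norm of the derivative, and the mean
  value inequality on a ball gives the Lipschitz estimate.\<close>

lemma smooth_on_locally_lipschitz:
  fixes f :: "'a::euclidean_space \<Rightarrow> 'b::real_normed_vector"
  assumes S: "open S" and f: "smooth_on S f" and x: "x \<in> S"
  obtains e K where "e > 0" and "ball x e \<subseteq> S"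
    and "\<And>y z. y \<in> ball x e \<Longrightarrow> z \<in> ball x e \<Longrightarrow> norm (f y - f z) \<le> K * norm (y - z)"
proof -
  let ?D = "\<lambda>y. frechet_derivative f (at y)"
  have "\<forall>\<^sub>F y in nhds x. norm (?D y b) < norm (?D x b) + 1" for b
  proof -
    have "continuous_on S (\<lambda>y. ?D y b)"
      by (rule smooth_on_continuous_on[OF smooth_on_frechet_derivative[OF f]])
    then have "isCont (\<lambda>y. ?D y b) x"
      using S x by (simp add: continuous_on_eq_continuous_at)
    then have "((\<lambda>y. norm (?D y b)) \<longlongrightarrow> norm (?D x b)) (nhds x)"
      by (intro tendsto_norm isCont_tendsto_nhds)
    then show ?thesis
      by (rule order_tendstoD(2)) simp
  qed
  then have "\<forall>\<^sub>F y in nhds x. y \<in> S \<and> (\<forall>b\<in>Basis. norm (?D y b) < norm (?D x b) + 1)"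
    by (intro eventually_conj eventually_ball_finite eventually_nhds_in_open S x) auto
  then obtain e where e: "e > 0"
    and B: "\<And>y. y \<in> ball x e \<Longrightarrow> y \<in> S \<and> (\<forall>b\<in>Basis. norm (?D y b) < norm (?D x b) + 1)"
    unfolding eventually_nhds_metric by (auto simp: dist_commute)
  define K where "K = (\<Sum>b\<in>Basis. norm (?D x b) + 1)"
  have D: "(f has_derivative ?D y) (at y)" if "y \<in> ball x e" for y
    using B[OF that] smooth_on_has_derivative[OF f] by blast
  have "onorm (?D y) \<le> K" if y: "y \<in> ball x e" for y
  proof (rule onorm_bound)
    show "K \<ge> 0" unfolding K_def by (intro sum_nonneg) auto
    fix v :: 'a
    interpret bounded_linear "?D y" using D[OF y] by (rule has_derivative_bounded_linear)
    have "?D y v = ?D y (\<Sum>b\<in>Basis. (v \<bullet> b) *\<^sub>R b)" by (simp add: euclidean_representation)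
    also have "\<dots> = (\<Sum>b\<in>Basis. (v \<bullet> b) *\<^sub>R ?D y b)" by (simp add: sum scaleR)
    also have "norm \<dots> \<le> (\<Sum>b\<in>Basis. norm v * (norm (?D x b) + 1))"
    proof (rule sum_norm_le)
      fix b :: 'a assume b: "b \<in> Basis"
      then show "norm ((v \<bullet> b) *\<^sub>R ?D y b) \<le> norm v * (norm (?D x b) + 1)"
        using B[OF y] by (auto intro!: mult_mono simp: Basis_le_norm less_imp_le)
    qed
    finally show "norm (?D y v) \<le> K * norm v"
      by (simp add: K_def sum_distrib_left mult.commute)
  qed
  then have "norm (f y - f z) \<le> K * norm (y - z)" if "y \<in> ball x e" "z \<in> ball x e" for y z
    using differentiable_bound[of "ball x e" f ?D K y z] that D
    by (auto intro: has_derivative_at_withinI)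
  then show ?thesis
    using that[OF e] B by blast
qed

text \<open>The dependence on time is measured by comparing the value at $(t,u)$ with the value at $(0,u)$,
  where \<open>u\<close> varies near \<open>u0\<close>: this is what makes the estimates uniform in \<open>u\<close>. A smooth function,
  being locally Lipschitz, preserves the property of changing by $O(t)$, and this replaces the
  differentiation of composed maps.\<close>

lemma smooth_compose_time_bigo:
  fixes k :: "'a::euclidean_space \<Rightarrow> 'b::real_normed_vector"
    and J :: "real \<times> 'c::real_normed_vector \<Rightarrow> 'a"
  assumes V: "open V" and k: "smooth_on V k" and J0: "J (0, u0) \<in> V"
    and J: "isCont J (0, u0)"
    and JO: "(\<lambda>x. norm (J x - J (0, snd x))) \<in> O[nhds (0, u0)](fst)"
  shows "(\<lambda>x. norm (k (J x) - k (J (0, snd x)))) \<in> O[nhds (0, u0)](fst)"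
proof -
  obtain e K where e: "e > 0" 
    and K: "\<And>y z. y \<in> ball (J (0, u0)) e \<Longrightarrow> z \<in> ball (J (0, u0)) e \<Longrightarrow> norm (k y - k z) \<le> K * norm (y - z)"
    using smooth_on_locally_lipschitz[OF V k J0] by metis
  have lim: "(J \<longlongrightarrow> J (0, u0)) (nhds (0, u0))"
    using J by (rule isCont_tendsto_nhds)
  have "isCont (\<lambda>x. (0::real, snd x)) (0::real, u0)"
    by (intro continuous_intros)
  from isCont_tendsto_nhds[OF this]
  have "((\<lambda>x. (0::real, snd x)) \<longlongrightarrow> (0, u0)) (nhds (0::real, u0))" by simp
  from filterlim_compose[OF lim this]
  have lim0: "((\<lambda>x. J (0, snd x)) \<longlongrightarrow> J (0, u0)) (nhds (0::real, u0))" .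
  have "\<forall>\<^sub>F x in nhds (0, u0). J x \<in> ball (J (0, u0)) e" "\<forall>\<^sub>F x in nhds (0::real, u0). J (0, snd x) \<in> ball (J (0, u0)) e"
    using lim lim0 e by (auto dest!: topological_tendstoD[where S = "ball (J (0, u0)) e"])
  then have "\<forall>\<^sub>F x in nhds (0, u0). norm (norm (k (J x) - k (J (0, snd x)))) \<le> K * norm (norm (J x - J (0, snd x)))"
    by eventually_elim (auto intro!: K)
  then have "(\<lambda>x. norm (k (J x) - k (J (0, snd x)))) \<in> O[nhds (0, u0)](\<lambda>x. norm (J x - J (0, snd x)))"
    by (rule bigoI)
  then show ?thesis using JO by (rule landau_o.big_trans)
qed

lemma smooth_time_bigo:
  fixes k :: "real \<times> 'a::euclidean_space \<Rightarrow> 'b::real_normed_vector"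
  assumes "open V" and "smooth_on V k" and "(0, u0) \<in> V"
  shows "(\<lambda>x. norm (k x - k (0, snd x))) \<in> O[nhds (0, u0)](fst)"
proof -
  have "norm (x - (0, snd x)) = \<bar>fst x\<bar>" for x :: "real \<times> 'a"
    by (cases x) (simp add: norm_Pair)
  then have "(\<lambda>x::real \<times> 'a. norm (x - (0, snd x))) \<in> O[nhds (0, u0)](fst)"
    by (intro bigoI[where c = 1]) simp
  then show ?thesis
    using smooth_compose_time_bigo[OF assms(1,2), of "\<lambda>x. x"] assms(3) by simp
qed

section \<open>Inverse matrices\<close>

lemma matrix_inv_inverse:
  fixes M :: "real ^ 'n ^ 'n"
  assumes "invertible M"
  shows "M ** matrix_inv M = mat 1" and "matrix_inv M ** M = mat 1"
  using someI_ex[OF assms[unfolded invertible_def]] by (simp_all add: matrix_inv_def)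

text \<open>Cramer's rule, in the form that exhibits the entries of the inverse as continuous functions of
  the entries of the matrix.\<close>

lemma matrix_inv_nth:
  fixes M :: "real ^ 'n ^ 'n"
  assumes "invertible M"
  shows "matrix_inv M $ i $ j = det (\<chi> k l. if l = i then axis j 1 $ k else M $ k $ l) / det M"
proof -
  have "M *v (matrix_inv M *v axis j 1) = axis j 1"
    using assms by (simp add: matrix_vector_mul_assoc matrix_inv_inverse)
  then have "matrix_inv M *v axis j 1 = (\<chi> i. det (\<chi> k l. if l = i then axis j 1 $ k else M $ k $ l) / det M)"
    using assms by (subst (asm) cramer) (auto simp: invertible_det_nz)
  then have "(matrix_inv M *v axis j 1) $ i = det (\<chi> k l. if l = i then axis j 1 $ k else M $ k $ l) / det M"
    by simp
  then show ?thesis by (simp add: matrix_vector_mul_component column_def matrix_vector_mult_basis)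
qed

lemma continuous_on_det:
  fixes M :: "'a::topological_space \<Rightarrow> real ^ 'n ^ 'n"
  assumes "\<And>i j. continuous_on S (\<lambda>x. M x $ i $ j)"
  shows "continuous_on S (\<lambda>x. det (M x))"
  unfolding det_def by (intro continuous_intros assms)

lemma continuous_on_matrix_inv:
  fixes M :: "'a::topological_space \<Rightarrow> real ^ 'n ^ 'n"
  assumes "continuous_on S M" and "\<And>x. x \<in> S \<Longrightarrow> invertible (M x)"
  shows "continuous_on S (\<lambda>x. matrix_inv (M x) $ i $ j)"
proof -
  have c: "continuous_on S (\<lambda>x. M x $ k $ l)" for k l
    by (intro continuous_intros assms)
  have "continuous_on S (\<lambda>x. det (\<chi> k l. if l = i then axis j 1 $ k else M x $ k $ l) / det (M x))"
  proof (intro continuous_on_divide continuous_on_det ballI)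
    show "det (M x) \<noteq> 0" if "x \<in> S" for x
      using assms(2)[OF that] by (simp add: invertible_det_nz)
    show "continuous_on S (\<lambda>x. (\<chi> k l. if l = i then axis j 1 $ k else M x $ k $ l) $ k $ l)" for k l
      by (cases "l = i") (auto intro!: continuous_intros c)
  qed (rule c)
  then show ?thesis
    by (rule continuous_on_eq) (simp add: matrix_inv_nth[OF assms(2)])
qed

lemma positive_definite_invertible:
  fixes g :: "real ^ 'n ^ 'n"
  assumes "\<And>v. v \<noteq> 0 \<Longrightarrow> v \<bullet> (g *v v) > 0"
  shows "invertible g"
  unfolding invertible_left_inverse
proof (rule iffD2[OF matrix_left_invertible_ker], intro allI impI)
  fix v assume "g *v v = 0"
  then show "v = 0" using assms[of v] by auto
qed


section \<open>Charts and Jacobians\<close>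

lemma chart_inv_coords: "is_chart c \<Longrightarrow> p \<in> chart_dom c \<Longrightarrow> chart_inv c (coords c p) = p"
  and coords_chart_inv: "is_chart c \<Longrightarrow> u \<in> coords c ` chart_dom c \<Longrightarrow> coords c (chart_inv c u) = u"
  and chart_inv_in_dom: "is_chart c \<Longrightarrow> u \<in> coords c ` chart_dom c \<Longrightarrow> chart_inv c u \<in> chart_dom c"
  and continuous_on_coords: "is_chart c \<Longrightarrow> continuous_on (chart_dom c) (coords c)"
  and continuous_on_chart_inv: "is_chart c \<Longrightarrow> continuous_on (coords c ` chart_dom c) (chart_inv c)"
  and open_chart_dom: "is_chart c \<Longrightarrow> open (chart_dom c)"
  and open_chart_image: "is_chart c \<Longrightarrow> open (coords c ` chart_dom c)"
  by (auto simp: is_chart_def homeomorphism_def)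

lemma open_coords_image:
  assumes c: "is_chart c" and "open U" and "U \<subseteq> chart_dom c"
  shows "open (coords c ` U)"
proof -
  have "coords c ` U = coords c ` chart_dom c \<inter> chart_inv c -` U"
    using assms by (auto simp: chart_inv_coords coords_chart_inv image_iff)
  then show ?thesis
    using continuous_open_preimage[OF continuous_on_chart_inv[OF c] open_chart_image[OF c] \<open>open U\<close>] by simp
qed

lemma atlas_chart: "smooth_atlas A \<Longrightarrow> c \<in> A \<Longrightarrow> is_chart c"
  by (simp add: smooth_atlas_def)

lemma id_in_smooth_maps: "smooth_atlas A \<Longrightarrow> id \<in> smooth_maps A A"
  by (auto simp: smooth_maps_def smooth_atlas_def)

lemma smooth_maps_differentiable:
  assumes "f \<in> smooth_maps A B" "c \<in> A" "d \<in> B" "p \<in> chart_dom c" "f p \<in> chart_dom d"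
  shows "(coords d \<circ> f \<circ> chart_inv c) differentiable (at (coords c p))"
  by (rule smooth_on_differentiable[where S = "coords c ` (chart_dom c \<inter> f -` chart_dom d)"])
    (use assms in \<open>auto simp: smooth_maps_def\<close>)

lemma jacobian_in_comp:
  assumes f: "f \<in> smooth_maps A B" and g: "g \<in> smooth_maps B C"
    and A: "smooth_atlas A" and B: "smooth_atlas B"
    and c: "c \<in> A" "p \<in> chart_dom c" and d: "d \<in> B" "f p \<in> chart_dom d"
    and e: "e \<in> C" "g (f p) \<in> chart_dom e"
  shows "jacobian_in c e (g \<circ> f) p = jacobian_in d e g (f p) ** jacobian_in c d f p"
proof -
  note c' = atlas_chart[OF A c(1)] and d' = atlas_chart[OF B d(1)]
  let ?F = "coords d \<circ> f \<circ> chart_inv c" and ?G = "coords e \<circ> g \<circ> chart_inv d"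
  let ?F' = "frechet_derivative ?F (at (coords c p))"
  let ?G' = "frechet_derivative ?G (at (coords d (f p)))"
  have F: "(?F has_derivative ?F') (at (coords c p))"
    using smooth_maps_differentiable[OF f c(1) d(1) c(2) d(2)] frechet_derivative_works by blast
  have G: "(?G has_derivative ?G') (at (coords d (f p)))"
    using smooth_maps_differentiable[OF g d(1) e(1) d(2) e(2)] frechet_derivative_works by blast
  let ?U = "chart_dom c \<inter> f -` chart_dom d"
  have "continuous_on UNIV f" using f by (simp add: smooth_maps_def)
  then have U: "open ?U"
    by (intro open_Int open_chart_dom c' open_vimage d')
  have "?F (coords c p) = coords d (f p)"
    by (simp add: chart_inv_coords[OF c' c(2)])
  then have "(?G \<circ> ?F has_derivative ?G' \<circ> ?F') (at (coords c p))"
    using F G by (intro diff_chain_at) simp_all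
  then have "(coords e \<circ> (g \<circ> f) \<circ> chart_inv c has_derivative ?G' \<circ> ?F') (at (coords c p))"
    by (rule has_derivative_transform_within_open[OF _ open_coords_image[OF c' U]])
      (use c d in \<open>auto simp: chart_inv_coords[OF c'] chart_inv_coords[OF d']\<close>)
  then have "jacobian_in c e (g \<circ> f) p = matrix (?G' \<circ> ?F')"
    unfolding jacobian_in_def using frechet_derivative_at by metis
  also have "\<dots> = matrix ?G' ** matrix ?F'"
    by (rule matrix_compose) (use F G in \<open>auto intro: has_derivative_linear\<close>)
  finally show ?thesis by (simp add: jacobian_in_def)
qed

text \<open>The transformation law that characterises a section of $T^*M \otimes f^{-1}(TN)$ among arbitrary
  families of components. It is what makes the scalar product of two sections independent of the
  charts.\<close>

definition mixed_tensorial ::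
  "('p, 'm::finite) chart set \<Rightarrow> ('q, 'n::finite) chart set \<Rightarrow> ('p \<Rightarrow> 'q) \<Rightarrow> ('p, 'm, 'q, 'n) mixed_section \<Rightarrow> bool"
where
  "mixed_tensorial A B f S \<longleftrightarrow>
    (\<forall>c\<in>A. \<forall>c'\<in>A. \<forall>d\<in>B. \<forall>d'\<in>B. \<forall>a\<in>chart_dom c \<inter> chart_dom c'. f a \<in> chart_dom d \<inter> chart_dom d' \<longrightarrow>
      S c' d' a = transition_jacobian d d' (f a) ** S c d a ** transition_jacobian c' c a)"

text \<open>The chain rule, applied to $f = \mathrm{id} \circ f$ in the target and to
  $f = f \circ \mathrm{id}$ in the source.\<close>

lemma differential_section_tensorial:
  assumes A: "smooth_atlas A" and B: "smooth_atlas B" and f: "f \<in> smooth_maps A B"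
  shows "mixed_tensorial A B f (differential_section f)"
  unfolding mixed_tensorial_def
proof (intro ballI impI)
  fix c c' d d' a
  assume *: "c \<in> A" "c' \<in> A" "d \<in> B" "d' \<in> B" "a \<in> chart_dom c \<inter> chart_dom c'"
    "f a \<in> chart_dom d \<inter> chart_dom d'"
  have "jacobian_in c' d' (id \<circ> f) a = transition_jacobian d d' (f a) ** jacobian_in c' d f a"
    by (rule jacobian_in_comp[OF f id_in_smooth_maps[OF B] A B]) (use * in auto)
  moreover have "jacobian_in c' d (f \<circ> id) a = jacobian_in c d f (id a) ** transition_jacobian c' c a"
    by (rule jacobian_in_comp[OF id_in_smooth_maps[OF A] f A A]) (use * in auto)
  ultimately show "differential_section f c' d' a =
      transition_jacobian d d' (f a) ** differential_section f c d a ** transition_jacobian c' c a"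
    by (simp add: differential_section_def matrix_mul_assoc)
qed

section \<open>Product charts\<close>

definition join_vec :: "real ^ 'm \<Rightarrow> real ^ 'n \<Rightarrow> real ^ ('m::finite + 'n::finite)" where
  "join_vec u v = (\<chi> k. case k of Inl \<alpha> \<Rightarrow> u $ \<alpha> | Inr i \<Rightarrow> v $ i)"

definition left_vec :: "real ^ ('m::finite + 'n::finite) \<Rightarrow> real ^ 'm" where
  "left_vec w = (\<chi> \<alpha>. w $ Inl \<alpha>)"

definition right_vec :: "real ^ ('m::finite + 'n::finite) \<Rightarrow> real ^ 'n" where
  "right_vec w = (\<chi> i. w $ Inr i)"

lemma join_vec_simps [simp]:
  "left_vec (join_vec u v) = u" "right_vec (join_vec u v) = v"
  "join_vec (left_vec w) (right_vec w) = w"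
  "join_vec u v $ Inl \<alpha> = u $ \<alpha>" "join_vec u v $ Inr i = v $ i"
  by (auto simp: join_vec_def left_vec_def right_vec_def vec_eq_iff split: sum.split)

lemma join_parts_axis [simp]:
  "left_vec (axis (Inl \<alpha>) x) = axis \<alpha> x" "right_vec (axis (Inr i) x) = axis i x"
  by (auto simp: left_vec_def right_vec_def vec_eq_iff axis_def)

lemma bounded_linear_left_vec: "bounded_linear left_vec"
  and bounded_linear_right_vec: "bounded_linear right_vec"
  by (auto simp: left_vec_def right_vec_def vec_eq_iff linear_conv_bounded_linear[symmetric] intro!: linearI)

lemma bounded_linear_join_vec: "bounded_linear (\<lambda>x. join_vec (fst x) (snd x))"
  by (auto simp: join_vec_def vec_eq_iff linear_conv_bounded_linear[symmetric] split: sum.split intro!: linearI)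

lemma coords_product_chart: "coords (product_chart c d) (p, q) = join_vec (coords c p) (coords d q)"
  and chart_dom_product_chart: "chart_dom (product_chart c d) = chart_dom c \<times> chart_dom d"
  by (simp_all add: product_chart_def join_vec_def)

lemma chart_inv_product_chart:
  assumes "is_chart c" "is_chart d"
    and "left_vec w \<in> coords c ` chart_dom c" "right_vec w \<in> coords d ` chart_dom d"
  shows "chart_inv (product_chart c d) w = (chart_inv c (left_vec w), chart_inv d (right_vec w))"
proof -
  have "inj_on (coords (product_chart c d)) (chart_dom (product_chart c d))"
    by (rule inj_on_inverseI[where g = "\<lambda>w. (chart_inv c (left_vec w), chart_inv d (right_vec w))"])
      (use assms in \<open>auto simp: coords_product_chart chart_dom_product_chart chart_inv_coords\<close>)
  moreover have "w = coords (product_chart c d) (chart_inv c (left_vec w), chart_inv d (right_vec w))"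
    using assms by (simp add: coords_product_chart coords_chart_inv)
  moreover have "(chart_inv c (left_vec w), chart_inv d (right_vec w)) \<in> chart_dom (product_chart c d)"
    using assms by (simp add: chart_dom_product_chart chart_inv_in_dom)
  ultimately show ?thesis
    unfolding chart_inv_def[of "product_chart c d"] by (metis inv_into_f_f)
qed

lemma product_chart_image:
  "coords (product_chart c d) ` chart_dom (product_chart c d) =
     {w. left_vec w \<in> coords c ` chart_dom c \<and> right_vec w \<in> coords d ` chart_dom d}"
proof (intro equalityI subsetI)
  fix w assume "w \<in> {w. left_vec w \<in> coords c ` chart_dom c \<and> right_vec w \<in> coords d ` chart_dom d}"
  then obtain p q where "p \<in> chart_dom c" "q \<in> chart_dom d" "left_vec w = coords c p" "right_vec w = coords d q"
    by auto
  moreover from this have "w = join_vec (coords c p) (coords d q)"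
    using join_vec_simps(3)[of w] by simp
  ultimately show "w \<in> coords (product_chart c d) ` chart_dom (product_chart c d)"
    by (intro image_eqI[of _ _ "(p, q)"]) (simp_all add: coords_product_chart chart_dom_product_chart)
qed (auto simp: coords_product_chart chart_dom_product_chart)

lemma open_join_parts:
  assumes "open U" "open V"
  shows "open {w. left_vec w \<in> U \<and> right_vec w \<in> V}"
proof -
  have "open (left_vec -` U \<inter> right_vec -` V)"
    using assms by (intro open_Int open_vimage linear_continuous_on bounded_linear_left_vec bounded_linear_right_vec)
  then show ?thesis by (simp add: vimage_def Collect_conj_eq)
qed

text \<open>A change of product charts acts on the two groups of coordinates separately, so its Jacobian is
  block diagonal; the diagonal blocks are the ones that enter the transformation of $T^i_\alpha$.\<close>

lemma product_transition_jacobian: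
  assumes A: "smooth_atlas A" and B: "smooth_atlas B"
    and c: "c \<in> A" "c' \<in> A" "p \<in> chart_dom c \<inter> chart_dom c'"
    and d: "d \<in> B" "d' \<in> B" "q \<in> chart_dom d \<inter> chart_dom d'"
  shows "transition_jacobian (product_chart c d) (product_chart c' d') (p, q) $ Inl \<alpha> $ Inl \<beta> =
      transition_jacobian c c' p $ \<alpha> $ \<beta>"
    and "transition_jacobian (product_chart c d) (product_chart c' d') (p, q) $ Inr i $ Inr j =
      transition_jacobian d d' q $ i $ j"
proof -
  note ch = atlas_chart[OF A c(1)] atlas_chart[OF A c(2)] atlas_chart[OF B d(1)] atlas_chart[OF B d(2)]
  let ?\<tau> = "coords c' \<circ> id \<circ> chart_inv c" and ?\<sigma> = "coords d' \<circ> id \<circ> chart_inv d"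
  let ?G = "coords (product_chart c' d') \<circ> id \<circ> chart_inv (product_chart c d)"
  let ?w = "coords (product_chart c d) (p, q)"
  define \<tau>' where "\<tau>' = frechet_derivative ?\<tau> (at (coords c p))"
  define \<sigma>' where "\<sigma>' = frechet_derivative ?\<sigma> (at (coords d q))"
  have \<tau>: "(?\<tau> has_derivative \<tau>') (at (left_vec ?w))"
    using smooth_maps_differentiable[OF id_in_smooth_maps[OF A] c(1,2)] c(3) frechet_derivative_works
    by (auto simp: coords_product_chart \<tau>'_def)
  have \<sigma>: "(?\<sigma> has_derivative \<sigma>') (at (right_vec ?w))"
    using smooth_maps_differentiable[OF id_in_smooth_maps[OF B] d(1,2)] d(3) frechet_derivative_works
    by (auto simp: coords_product_chart \<sigma>'_def)
  have "((\<lambda>w. ?\<tau> (left_vec w)) has_derivative (\<lambda>h. \<tau>' (left_vec h))) (at ?w)"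
    by (rule has_derivative_compose[OF bounded_linear_imp_has_derivative[OF bounded_linear_left_vec] \<tau>])
  moreover have "((\<lambda>w. ?\<sigma> (right_vec w)) has_derivative (\<lambda>h. \<sigma>' (right_vec h))) (at ?w)"
    by (rule has_derivative_compose[OF bounded_linear_imp_has_derivative[OF bounded_linear_right_vec] \<sigma>])
  ultimately have "((\<lambda>w. join_vec (fst (?\<tau> (left_vec w), ?\<sigma> (right_vec w))) (snd (?\<tau> (left_vec w), ?\<sigma> (right_vec w))))
      has_derivative (\<lambda>h. join_vec (fst (\<tau>' (left_vec h), \<sigma>' (right_vec h))) (snd (\<tau>' (left_vec h), \<sigma>' (right_vec h)))))
      (at ?w)"
    by (intro bounded_linear.has_derivative[OF bounded_linear_join_vec] has_derivative_Pair)
  then have D: "((\<lambda>w. join_vec (?\<tau> (left_vec w)) (?\<sigma> (right_vec w)))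
      has_derivative (\<lambda>h. join_vec (\<tau>' (left_vec h)) (\<sigma>' (right_vec h)))) (at ?w)" by simp
  define V where "V = {w. left_vec w \<in> coords c ` (chart_dom c \<inter> chart_dom c') \<and>
    right_vec w \<in> coords d ` (chart_dom d \<inter> chart_dom d')}"
  have V: "open V" unfolding V_def
    by (intro open_join_parts open_coords_image ch open_Int open_chart_dom) auto
  have wV: "?w \<in> V" using c(3) d(3) by (auto simp: V_def coords_product_chart)
  have G: "(?G has_derivative (\<lambda>h. join_vec (\<tau>' (left_vec h)) (\<sigma>' (right_vec h)))) (at ?w)"
  proof (rule has_derivative_transform_within_open[OF D V wV])
    fix w assume "w \<in> V"
    then have "left_vec w \<in> coords c ` chart_dom c" "right_vec w \<in> coords d ` chart_dom d"
      unfolding V_def by blast+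
    from chart_inv_product_chart[OF ch(1,3) this]
    show "join_vec (?\<tau> (left_vec w)) (?\<sigma> (right_vec w)) = ?G w"
      by (simp add: coords_product_chart)
  qed
  have J: "transition_jacobian (product_chart c d) (product_chart c' d') (p, q) =
      matrix (\<lambda>h. join_vec (\<tau>' (left_vec h)) (\<sigma>' (right_vec h)))"
    unfolding jacobian_in_def frechet_derivative_at[OF G, symmetric] by (rule refl)
  show "transition_jacobian (product_chart c d) (product_chart c' d') (p, q) $ Inl \<alpha> $ Inl \<beta> =
      transition_jacobian c c' p $ \<alpha> $ \<beta>"
    unfolding J by (simp add: matrix_def jacobian_in_def \<tau>'_def)
  show "transition_jacobian (product_chart c d) (product_chart c' d') (p, q) $ Inr i $ Inr j =
      transition_jacobian d d' q $ i $ j"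
    unfolding J by (simp add: matrix_def jacobian_in_def \<sigma>'_def)
qed

lemma sum_UNIV_sum:
  fixes g :: "'m::finite + 'n::finite \<Rightarrow> 'a::comm_monoid_add"
  shows "(\<Sum>k\<in>UNIV. g k) = (\<Sum>\<alpha>\<in>UNIV. g (Inl \<alpha>)) + (\<Sum>i\<in>UNIV. g (Inr i))"
proof -
  have "(\<Sum>k\<in>UNIV. g k) = sum g (UNIV <+> UNIV)" by (simp only: UNIV_Plus_UNIV)
  also have "\<dots> = (\<Sum>\<alpha>\<in>UNIV. g (Inl \<alpha>)) + (\<Sum>i\<in>UNIV. g (Inr i))"
    by (simp add: sum.Plus del: UNIV_Plus_UNIV)
  finally show ?thesis .
qed

lemma product_atlasI: "c \<in> A \<Longrightarrow> d \<in> B \<Longrightarrow> product_chart c d \<in> product_atlas A B"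
  unfolding product_atlas_def by (intro CollectI exI[of _ c] exI[of _ d] conjI refl)

text \<open>In the transformation law of \<open>T\<close> on the product, the sums over all $m+n$ indices collapse to
  sums over $T^j_\beta$, because all other components of \<open>T\<close> vanish; what remains is the law
  of a section along \<open>f\<close>.\<close>

lemma tensor_along_tensorial:
  assumes A: "smooth_atlas A" and B: "smooth_atlas B"
    and T: "tensor_field_11 (product_atlas A B) T" and mixed: "only_mixed_components A B T"
  shows "mixed_tensorial A B f (tensor_along T f)"
  unfolding mixed_tensorial_def
proof (intro ballI impI)
  fix c c' d d' a
  assume *: "c \<in> A" "c' \<in> A" "d \<in> B" "d' \<in> B" "a \<in> chart_dom c \<inter> chart_dom c'"
    "f a \<in> chart_dom d \<inter> chart_dom d'"
  let ?x = "product_chart c d" and ?x' = "product_chart c' d'" and ?T = "T (product_chart c d) (a, f a)"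
  let ?J = "transition_jacobian ?x ?x' (a, f a)" and ?J' = "transition_jacobian ?x' ?x (a, f a)"
  have x: "?x \<in> product_atlas A B" "?x' \<in> product_atlas A B"
    using * by (auto intro: product_atlasI)
  have pt: "(a, f a) \<in> chart_dom ?x \<inter> chart_dom ?x'"
    using * by (simp add: chart_dom_product_chart)
  have law: "T ?x' (a, f a) = ?J ** ?T ** ?J'"
    using T[unfolded tensor_field_11_def, THEN conjunct2, rule_format, OF x pt] by simp
  have "?T $ I $ K \<noteq> 0 \<Longrightarrow> \<exists>i \<alpha>. I = Inr i \<and> K = Inl \<alpha>" for I K
    using mixed[unfolded only_mixed_components_def, rule_format, OF *(1,3), of a "f a" I K] * by simp
  from this[of "Inl _"] this[of _ "Inr _"]
  have zero: "?T $ Inl \<alpha> $ K = 0" "?T $ Inr i $ Inr j = 0" for \<alpha> K i j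
    by auto
  show "tensor_along T f c' d' a =
      transition_jacobian d d' (f a) ** tensor_along T f c d a ** transition_jacobian c' c a"
  proof -
    have J: "?J $ Inr i $ Inr j = transition_jacobian d d' (f a) $ i $ j"
      "?J' $ Inl \<alpha> $ Inl \<beta> = transition_jacobian c' c a $ \<alpha> $ \<beta>" for i j \<alpha> \<beta>
      by (rule product_transition_jacobian[OF A B]; use * in simp)+
    show ?thesis
      unfolding vec_eq_iff tensor_along_def law
      by (simp add: matrix_matrix_mult_def sum_UNIV_sum zero J)
  qed
qed

section \<open>The scalar product of sections\<close>

definition mixed_form ::
  "real ^ 'm ^ 'm \<Rightarrow> real ^ 'n ^ 'n \<Rightarrow> real ^ 'm ^ 'n \<Rightarrow> real ^ 'm ^ 'n \<Rightarrow> real" where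
  "mixed_form P G X Y = (\<Sum>\<alpha>\<in>UNIV. \<Sum>\<beta>\<in>UNIV. \<Sum>i\<in>UNIV. \<Sum>j\<in>UNIV.
     P $ \<alpha> $ \<beta> * G $ i $ j * X $ i $ \<alpha> * Y $ j $ \<beta>)"

text \<open>As a trace of a product of matrices, the form can be manipulated by associativity and cyclicity
  instead of fourfold sums.\<close>

lemma mixed_form_trace: "mixed_form P G X Y = trace (P ** transpose Y ** transpose G ** X)"
proof -
  have "mixed_form P G X Y = (\<Sum>\<alpha>\<in>UNIV. \<Sum>\<beta>\<in>UNIV. \<Sum>i\<in>UNIV. \<Sum>j\<in>UNIV.
     P $ \<alpha> $ \<beta> * Y $ j $ \<beta> * G $ i $ j * X $ i $ \<alpha>)"
    by (simp add: mixed_form_def mult_ac)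
  also have "\<dots> = (\<Sum>\<alpha>\<in>UNIV. \<Sum>i\<in>UNIV. \<Sum>j\<in>UNIV. \<Sum>\<beta>\<in>UNIV.
     P $ \<alpha> $ \<beta> * Y $ j $ \<beta> * G $ i $ j * X $ i $ \<alpha>)"
    by (rule sum.cong[OF refl], subst sum.swap, rule sum.cong[OF refl], rule sum.swap)
  also have "\<dots> = trace (P ** transpose Y ** transpose G ** X)"
    by (simp add: trace_def matrix_matrix_mult_def transpose_def sum_distrib_right)
  finally show ?thesis .
qed

lemma matrix_inv_unique:
  fixes M N :: "real ^ 'n ^ 'n"
  assumes "M ** N = mat 1"
  shows "matrix_inv M = N"
proof -
  have "invertible M" using assms invertible_right_inverse by blast
  then have "matrix_inv M ** (M ** N) = N"
    by (simp add: matrix_mul_assoc matrix_inv_inverse)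
  then show ?thesis using assms by simp
qed

text \<open>Here \<open>J\<close> is the Jacobian of the change of coordinates in the source and \<open>K\<close> the one in the
  target. In the trace, the factors \<open>J\<close> introduced by the sections cancel against those in the
  inverse of the transformed metric, up to a conjugation by \<open>J\<close>, and the factors \<open>K\<close> are absorbed
  by the metric of the target.\<close>

lemma mixed_form_change_of_charts:
  fixes g J :: "real ^ 'm ^ 'm" and K :: "real ^ 'n ^ 'n"
  assumes g: "invertible g" and J: "invertible J"
  shows "mixed_form (matrix_inv (transpose J ** g ** J)) G (K ** X ** J) (K ** Y ** J) =
    mixed_form (matrix_inv g) (transpose K ** G ** K) X Y"
proof -
  let ?I = "matrix_inv J" and ?P = "matrix_inv g"
  have J1: "J ** ?I = mat 1" "?I ** J = mat 1" using matrix_inv_inverse[OF J] .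
  have J2: "transpose J ** transpose ?I = mat 1" "transpose ?I ** transpose J = mat 1"
    by (simp_all add: J1 flip: matrix_transpose_mul)
  have P: "matrix_inv (transpose J ** g ** J) = ?I ** ?P ** transpose ?I"
  proof (rule matrix_inv_unique)
    have "transpose J ** g ** J ** (?I ** ?P ** transpose ?I) =
      transpose J ** g ** (J ** ?I) ** ?P ** transpose ?I"
      by (simp add: matrix_mul_assoc)
    also have "\<dots> = transpose J ** (g ** ?P) ** transpose ?I"
      by (simp add: J1 matrix_mul_assoc)
    also have "\<dots> = mat 1" by (simp add: matrix_inv_inverse[OF g] J2)
    finally show "transpose J ** g ** J ** (?I ** ?P ** transpose ?I) = mat 1" .
  qed
  have "(?I ** ?P ** transpose ?I) ** transpose (K ** Y ** J) ** transpose G ** (K ** X ** J)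
     = ?I ** ?P ** (transpose ?I ** transpose J) ** transpose Y ** transpose K ** transpose G ** K ** X ** J"
    by (simp add: matrix_transpose_mul matrix_mul_assoc)
  also have "\<dots> = ?I ** (?P ** transpose Y ** transpose (transpose K ** G ** K) ** X ** J)"
    by (simp add: J2 matrix_transpose_mul matrix_mul_assoc)
  finally have "mixed_form (matrix_inv (transpose J ** g ** J)) G (K ** X ** J) (K ** Y ** J) =
     trace (?I ** (?P ** transpose Y ** transpose (transpose K ** G ** K) ** X ** J))"
    by (simp add: mixed_form_trace P)
  also have "\<dots> = trace (?P ** transpose Y ** transpose (transpose K ** G ** K) ** X ** (J ** ?I))"
    by (subst trace_mul_sym) (simp add: matrix_mul_assoc)
  finally show ?thesis by (simp add: J1 mixed_form_trace)
qed

lemma chart_at: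
  assumes "smooth_atlas A"
  shows "chart_at A a \<in> A" and "a \<in> chart_dom (chart_at A a)"
proof -
  have "\<exists>c. c \<in> A \<and> a \<in> chart_dom c" using assms unfolding smooth_atlas_def by blast
  from someI_ex[OF this] show "chart_at A a \<in> A" and "a \<in> chart_dom (chart_at A a)"
    by (simp_all add: chart_at_def)
qed

lemma
  assumes "riemannian_metric A g" "c \<in> A"
  shows riemannian_metric_smooth: "smooth_on (coords c ` chart_dom c) (g c \<circ> chart_inv c)"
    and riemannian_metric_sym: "a \<in> chart_dom c \<Longrightarrow> transpose (g c a) = g c a"
    and riemannian_metric_pos: "a \<in> chart_dom c \<Longrightarrow> v \<noteq> 0 \<Longrightarrow> v \<bullet> (g c a *v v) > 0"
  using assms(1)[unfolded riemannian_metric_def, THEN conjunct1]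
    assms(1)[unfolded riemannian_metric_def, THEN conjunct2, THEN conjunct1] assms(2) by blast+

lemma metric_invertible:
  assumes "riemannian_metric A g" "c \<in> A" "a \<in> chart_dom c"
  shows "invertible (g c a)"
  by (rule positive_definite_invertible) (rule riemannian_metric_pos[OF assms])

text \<open>The scalar product was defined with charts selected by choice, which vary with the point in an
  uncontrolled way. This lemma allows a fixed pair of charts in a neighbourhood of a point; without
  it neither continuity nor measurability of the integrand would be accessible.\<close>

lemma section_inner_in_charts:
  assumes M: "riemannian_manifold A \<phi>" and N: "riemannian_manifold B \<psi>"
    and S: "mixed_tensorial A B f S" and S': "mixed_tensorial A B f S'"
    and c: "c \<in> A" "a \<in> chart_dom c" and d: "d \<in> B" "f a \<in> chart_dom d"
  shows "section_inner A \<phi> B \<psi> f S S' a = mixed_form (matrix_inv (\<phi> c a)) (\<psi> d (f a)) (S c d a) (S' c d a)"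
proof -
  have A: "smooth_atlas A" "riemannian_metric A \<phi>" and B: "smooth_atlas B" "riemannian_metric B \<psi>"
    using M N by (auto simp: riemannian_manifold_def)
  define c' d' where "c' = chart_at A a" and "d' = chart_at B (f a)"
  note c' = chart_at[OF A(1), of a, folded c'_def] and d' = chart_at[OF B(1), of "f a", folded d'_def]
  let ?J = "transition_jacobian c' c a" and ?K = "transition_jacobian d d' (f a)"
  have \<phi>: "\<phi> c' a = transpose ?J ** \<phi> c a ** ?J"
    by (rule A(2)[unfolded riemannian_metric_def, THEN conjunct2, THEN conjunct2, rule_format])
      (use c c' in auto)
  have \<psi>: "\<psi> d (f a) = transpose ?K ** \<psi> d' (f a) ** ?K"
    by (rule B(2)[unfolded riemannian_metric_def, THEN conjunct2, THEN conjunct2, rule_format])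
      (use d d' in auto)
  have "det (\<phi> c' a) \<noteq> 0"
    using metric_invertible[OF A(2) c'] by (simp add: invertible_det_nz)
  then have J: "invertible ?J" by (simp add: \<phi> det_mul invertible_det_nz)
  have "S c' d' a = ?K ** S c d a ** ?J" "S' c' d' a = ?K ** S' c d a ** ?J"
    by (rule S[unfolded mixed_tensorial_def, rule_format] S'[unfolded mixed_tensorial_def, rule_format];
        use c c' d d' in simp)+
  then show ?thesis
    unfolding section_inner_def Let_def c'_def[symmetric] d'_def[symmetric] mixed_form_def[symmetric]
    by (simp only: \<phi> \<psi> mixed_form_change_of_charts[OF metric_invertible[OF A(2) c] J])
qed


lemma mixed_form_diff_left: "mixed_form P G (X - Z) Y = mixed_form P G X Y - mixed_form P G Z Y"
  and mixed_form_diff_right: "mixed_form P G X (Y - Z) = mixed_form P G X Y - mixed_form P G X Z"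
  by (simp_all add: mixed_form_def algebra_simps sum_subtractf)

lemma mixed_form_sym:
  assumes "transpose P = P" "transpose G = G"
  shows "mixed_form P G X Y = mixed_form P G Y X"
proof -
  have "mixed_form P G X Y = trace (transpose (P ** transpose Y ** transpose G ** X))"
    by (simp add: mixed_form_trace trace_def transpose_def)
  also have "\<dots> = trace (transpose X ** transpose G ** Y ** P)"
    by (simp add: matrix_transpose_mul assms matrix_mul_assoc)
  also have "\<dots> = mixed_form P G Y X"
    by (subst trace_mul_sym) (simp add: mixed_form_trace matrix_mul_assoc)
  finally show ?thesis .
qed

text \<open>The Gram determinant of \<open>X\<close> and \<open>Y\<close> does not change when \<open>X\<close> is replaced by \<open>X - Y\<close>. Hence the
  defect in the Cauchy-Schwarz inequality is quadratic in \<open>X - Y\<close>, so it vanishes to second order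
  where \<open>X = Y\<close>.\<close>

lemma cauchy_schwarz_defect:
  assumes "transpose P = P" "transpose G = G"
  shows "mixed_form P G X X * mixed_form P G Y Y - (mixed_form P G X Y)\<^sup>2 =
    mixed_form P G (X - Y) (X - Y) * mixed_form P G Y Y - (mixed_form P G (X - Y) Y)\<^sup>2"
  by (simp add: mixed_form_diff_left mixed_form_diff_right mixed_form_sym[OF assms, of Y X]
      power2_eq_square algebra_simps)

lemma transpose_matrix_inv:
  fixes g :: "real ^ 'n ^ 'n"
  assumes "invertible g" "transpose g = g"
  shows "transpose (matrix_inv g) = matrix_inv g"
proof -
  have "transpose (matrix_inv g ** g) = mat 1"
    using assms by (simp add: matrix_inv_inverse transpose_mat)
  then have "g ** transpose (matrix_inv g) = mat 1"
    by (simp add: matrix_transpose_mul assms)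
  then show ?thesis using matrix_inv_unique by metis
qed

lemma continuous_on_mixed_form:
  assumes "\<And>\<alpha> \<beta>. continuous_on S (\<lambda>x. P x $ \<alpha> $ \<beta>)" "\<And>i j. continuous_on S (\<lambda>x. G x $ i $ j)"
    and "\<And>i \<alpha>. continuous_on S (\<lambda>x. X x $ i $ \<alpha>)" "\<And>i \<alpha>. continuous_on S (\<lambda>x. Y x $ i $ \<alpha>)"
  shows "continuous_on S (\<lambda>x. mixed_form (P x) (G x) (X x) (Y x))"
  unfolding mixed_form_def by (intro continuous_intros assms)

lemma mixed_form_bigo:
  assumes "\<And>\<alpha> \<beta>. (\<lambda>x. P x $ \<alpha> $ \<beta>) \<in> O[E](\<lambda>_. 1)" "\<And>i j. (\<lambda>x. G x $ i $ j) \<in> O[E](\<lambda>_. 1)"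
    and "\<And>i \<alpha>. (\<lambda>x. X x $ i $ \<alpha>) \<in> O[E](g)" "\<And>i \<alpha>. (\<lambda>x. Y x $ i $ \<alpha>) \<in> O[E](h)"
  shows "(\<lambda>x. mixed_form (P x) (G x) (X x) (Y x)) \<in> O[E](\<lambda>x. g x * h x)"
proof -
  have "(\<lambda>x. P x $ \<alpha> $ \<beta> * G x $ i $ j * X x $ i $ \<alpha> * Y x $ j $ \<beta>) \<in> O[E](\<lambda>x. 1 * 1 * g x * h x)" for \<alpha> \<beta> i j
    by (intro landau_o.big.mult assms)
  then show ?thesis unfolding mixed_form_def by (intro big_sum_in_bigo) simp
qed

lemma continuous_on_imp_bigo_1:
  fixes g :: "'a::t2_space \<Rightarrow> real"
  assumes "open S" "continuous_on S g" "x \<in> S"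
  shows "g \<in> O[nhds x](\<lambda>_. 1)"
proof (rule bigoI_tendsto)
  have "isCont g x" using assms by (simp add: continuous_on_eq_continuous_at)
  from isCont_tendsto_nhds[OF this] show "((\<lambda>x. g x / 1) \<longlongrightarrow> g x) (nhds x)" by simp
qed simp

section \<open>The integrand along a variation\<close>

locale pde_variation =
  fixes A :: "('p::{t2_space, second_countable_topology}, 'm::finite) chart set"
    and \<phi> :: "('p, 'm) chart \<Rightarrow> 'p \<Rightarrow> real ^ 'm ^ 'm"
    and B :: "('q::{t2_space, second_countable_topology}, 'n::finite) chart set"
    and \<psi> :: "('q, 'n) chart \<Rightarrow> 'q \<Rightarrow> real ^ 'n ^ 'n"
    and T :: "('p \<times> 'q, 'm + 'n) chart \<Rightarrow> 'p \<times> 'q \<Rightarrow> real ^ ('m + 'n) ^ ('m + 'n)"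
    and f :: "'p \<Rightarrow> 'q" and \<epsilon> :: real and F :: "real \<Rightarrow> 'p \<Rightarrow> 'q"
  assumes M: "riemannian_manifold A \<phi>" and N: "riemannian_manifold B \<psi>"
    and T: "tensor_field_11 (product_atlas A B) T" "only_mixed_components A B T"
    and pde: "solves_pde A B T f"
    and variation: "smooth_variation A B f \<epsilon> F"
    and admissible: "\<And>t. t \<in> {-\<epsilon><..<\<epsilon>} \<Longrightarrow> F t \<in> functional_domain A \<phi> B \<psi> T"
begin

definition integrand :: "real \<Rightarrow> 'p \<Rightarrow> real" where
  "integrand t a =
    section_inner A \<phi> B \<psi> (F t) (differential_section (F t)) (differential_section (F t)) a *
    section_inner A \<phi> B \<psi> (F t) (tensor_along T (F t)) (tensor_along T (F t)) a /
    (section_inner A \<phi> B \<psi> (F t) (differential_section (F t)) (tensor_along T (F t)) a)\<^sup>2"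

text \<open>The suffix \<open>_in\<close> marks the expressions, in a chart \<open>c\<close> of the source and a chart \<open>d\<close> of the
  target, of the objects attached to \<open>F t\<close>; they are functions of the time and the coordinates
  jointly, defined on \<open>domain_in c d\<close>.\<close>

definition domain_in :: "('p, 'm) chart \<Rightarrow> ('q, 'n) chart \<Rightarrow> (real \<times> (real ^ 'm)) set" where
  "domain_in c d = {(t, coords c p) | t p. t \<in> {-\<epsilon><..<\<epsilon>} \<and> p \<in> chart_dom c \<and> F t p \<in> chart_dom d}"

definition map_in :: "('p, 'm) chart \<Rightarrow> ('q, 'n) chart \<Rightarrow> real \<times> (real ^ 'm) \<Rightarrow> real ^ 'n" where
  "map_in c d = (\<lambda>(t, u). coords d (F t (chart_inv c u)))"

text \<open>The spatial derivatives are taken from the total derivative of the space-time map, in the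
  direction \<open>(0, axis \<alpha> 1)\<close>. In this form they inherit smoothness in the time as well.\<close>

definition differential_in :: "('p, 'm) chart \<Rightarrow> ('q, 'n) chart \<Rightarrow> real \<times> (real ^ 'm) \<Rightarrow> real ^ 'm ^ 'n" where
  "differential_in c d x = (\<chi> i \<alpha>. frechet_derivative (map_in c d) (at x) (0, axis \<alpha> 1) $ i)"

definition tensor_in :: "('p, 'm) chart \<Rightarrow> ('q, 'n) chart \<Rightarrow> real \<times> (real ^ 'm) \<Rightarrow> real ^ 'm ^ 'n" where
  "tensor_in c d x = (\<chi> i \<alpha>. (T (product_chart c d) \<circ> chart_inv (product_chart c d))
     (join_vec (snd x) (map_in c d x)) $ Inr i $ Inl \<alpha>)"

definition source_metric_inv_in :: "('p, 'm) chart \<Rightarrow> real \<times> (real ^ 'm) \<Rightarrow> real ^ 'm ^ 'm" where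
  "source_metric_inv_in c x = matrix_inv ((\<phi> c \<circ> chart_inv c) (snd x))"

definition target_metric_in :: "('p, 'm) chart \<Rightarrow> ('q, 'n) chart \<Rightarrow> real \<times> (real ^ 'm) \<Rightarrow> real ^ 'n ^ 'n" where
  "target_metric_in c d x = (\<psi> d \<circ> chart_inv d) (map_in c d x)"

abbreviation (input) inner_in where
  "inner_in c d X Y x \<equiv> mixed_form (source_metric_inv_in c x) (target_metric_in c d x) (X x) (Y x)"

lemmas atlas = M[unfolded riemannian_manifold_def, THEN conjunct1] N[unfolded riemannian_manifold_def, THEN conjunct1]
lemmas metric = M[unfolded riemannian_manifold_def, THEN conjunct2] N[unfolded riemannian_manifold_def, THEN conjunct2]

lemma \<epsilon>: "\<epsilon> > 0" and F0: "F 0 = f"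
  and continuous_F: "continuous_on ({-\<epsilon><..<\<epsilon>} \<times> UNIV) (\<lambda>x. F (fst x) (snd x))"
  using variation[unfolded smooth_variation_def split_beta] by blast+

lemma F_smooth: "t \<in> {-\<epsilon><..<\<epsilon>} \<Longrightarrow> F t \<in> smooth_maps A B"
  using admissible by (simp add: functional_domain_def)

lemma F_nondegenerate: "t \<in> {-\<epsilon><..<\<epsilon>} \<Longrightarrow>
    section_inner A \<phi> B \<psi> (F t) (differential_section (F t)) (tensor_along T (F t)) a \<noteq> 0"
  using admissible by (simp add: functional_domain_def)

context
  fixes c :: "('p, 'm) chart" and d :: "('q, 'n) chart"
  assumes c: "c \<in> A" and d: "d \<in> B"
begin

lemmas charts = atlas_chart[OF atlas(1) c] atlas_chart[OF atlas(2) d]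

lemma domain_inD:
  assumes "x \<in> domain_in c d"
  shows "fst x \<in> {-\<epsilon><..<\<epsilon>}" "snd x \<in> coords c ` chart_dom c" "chart_inv c (snd x) \<in> chart_dom c"
    "F (fst x) (chart_inv c (snd x)) \<in> chart_dom d" "map_in c d x \<in> coords d ` chart_dom d"
    "chart_inv d (map_in c d x) = F (fst x) (chart_inv c (snd x))"
  using assms chart_inv_coords[OF charts(1)] chart_inv_coords[OF charts(2)]
  by (auto simp: domain_in_def map_in_def)

lemma domain_inI:
  "t \<in> {-\<epsilon><..<\<epsilon>} \<Longrightarrow> p \<in> chart_dom c \<Longrightarrow> F t p \<in> chart_dom d \<Longrightarrow> (t, coords c p) \<in> domain_in c d"
  by (auto simp: domain_in_def)

lemma open_domain_in: "open (domain_in c d)"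
proof -
  let ?D = "{-\<epsilon><..<\<epsilon>} \<times> coords c ` chart_dom c"
  let ?F = "\<lambda>x. F (fst x) (chart_inv c (snd x))"
  have "continuous_on ?D (\<lambda>x. (fst x, chart_inv c (snd x)))"
    by (intro continuous_intros continuous_on_compose2[OF continuous_on_chart_inv[OF charts(1)]]) auto
  then have "continuous_on ?D ?F"
    using continuous_on_compose2[OF continuous_F] by fastforce
  moreover have "open ?D"
    by (intro open_Times open_chart_image charts) simp
  ultimately have "open (?D \<inter> ?F -` chart_dom d)"
    by (rule continuous_open_preimage) (rule open_chart_dom[OF charts(2)])
  also have "?D \<inter> ?F -` chart_dom d = domain_in c d"
  proof (intro equalityI subsetI)
    fix x assume "x \<in> ?D \<inter> ?F -` chart_dom d"
    then show "x \<in> domain_in c d"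
      by (cases x) (auto simp: chart_inv_coords[OF charts(1)] intro!: domain_inI)
  next
    fix x assume "x \<in> domain_in c d"
    then show "x \<in> ?D \<inter> ?F -` chart_dom d" using domain_inD[of x] by (cases x) simp
  qed
  finally show ?thesis .
qed

lemma smooth_map_in: "smooth_on (domain_in c d) (map_in c d)"
  unfolding domain_in_def map_in_def
  using variation[unfolded smooth_variation_def, THEN conjunct2, THEN conjunct2, THEN conjunct2, rule_format, OF c d] .

lemma continuous_map_in: "continuous_on (domain_in c d) (map_in c d)"
  by (rule smooth_on_continuous_on[OF smooth_map_in])

lemma join_in_image:
  assumes "x \<in> domain_in c d"
  shows "join_vec (snd x) (map_in c d x) \<in> coords (product_chart c d) ` chart_dom (product_chart c d)"
  using domain_inD[OF assms] unfolding product_chart_image by simp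

lemma differential_section_in:
  assumes x: "x \<in> domain_in c d"
  shows "differential_section (F (fst x)) c d (chart_inv c (snd x)) = differential_in c d x"
proof -
  let ?D = "frechet_derivative (map_in c d) (at x)"
  obtain t u where [simp]: "x = (t, u)" by (cases x)
  have "(map_in c d has_derivative ?D) (at (t, u))"
    using smooth_on_has_derivative[OF smooth_map_in x] by simp
  moreover have "((\<lambda>u. (t, u)) has_derivative (\<lambda>h. (0, h))) (at u)"
    by (auto intro!: derivative_eq_intros)
  ultimately have "((\<lambda>u. map_in c d (t, u)) has_derivative (\<lambda>h. ?D (0, h))) (at u)"
    using has_derivative_compose[of "\<lambda>u. (t, u)"] by blast
  moreover have "(\<lambda>u. map_in c d (t, u)) = coords d \<circ> F t \<circ> chart_inv c"
    by (auto simp: map_in_def)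
  ultimately have "frechet_derivative (coords d \<circ> F t \<circ> chart_inv c) (at u) = (\<lambda>h. ?D (0, h))"
    using frechet_derivative_at by metis
  moreover have "coords c (chart_inv c u) = u"
    using domain_inD(2)[OF x] by (simp add: coords_chart_inv[OF charts(1)])
  ultimately show ?thesis
    by (simp add: differential_section_def jacobian_in_def matrix_def differential_in_def)
qed

lemma tensor_along_in:
  assumes x: "x \<in> domain_in c d"
  shows "tensor_along T (F (fst x)) c d (chart_inv c (snd x)) = tensor_in c d x"
  using domain_inD[OF x] chart_inv_product_chart[OF charts, of "join_vec (snd x) (map_in c d x)"]
  by (simp add: tensor_along_def tensor_in_def)

lemma section_inner_in:
  assumes x: "x \<in> domain_in c d"
    and S: "mixed_tensorial A B (F (fst x)) S" "S c d (chart_inv c (snd x)) = X x"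
    and S': "mixed_tensorial A B (F (fst x)) S'" "S' c d (chart_inv c (snd x)) = Y x"
  shows "section_inner A \<phi> B \<psi> (F (fst x)) S S' (chart_inv c (snd x)) = inner_in c d X Y x"
  using section_inner_in_charts[OF M N S(1) S'(1) c _ d] domain_inD[OF x] S S'
  by (simp add: source_metric_inv_in_def target_metric_in_def)

lemma section_inner_differential_tensor_in:
  fixes x
  assumes x: "x \<in> domain_in c d"
  defines "a \<equiv> chart_inv c (snd x)" and "g \<equiv> F (fst x)"
  shows
    "section_inner A \<phi> B \<psi> g (differential_section g) (differential_section g) a =
       inner_in c d (differential_in c d) (differential_in c d) x"
    "section_inner A \<phi> B \<psi> g (tensor_along T g) (tensor_along T g) a =
       inner_in c d (tensor_in c d) (tensor_in c d) x"
    "section_inner A \<phi> B \<psi> g (differential_section g) (tensor_along T g) a =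
       inner_in c d (differential_in c d) (tensor_in c d) x"
proof -
  note \<delta> = differential_section_tensorial[OF atlas F_smooth[OF domain_inD(1)[OF x]]] differential_section_in[OF x]
  note \<tau> = tensor_along_tensorial[OF atlas T, of "F (fst x)"] tensor_along_in[OF x]
  show "section_inner A \<phi> B \<psi> g (differential_section g) (differential_section g) a =
       inner_in c d (differential_in c d) (differential_in c d) x"
    unfolding a_def g_def by (rule section_inner_in[OF x, where X = "differential_in c d" and Y = "differential_in c d", OF \<delta> \<delta>])
  show "section_inner A \<phi> B \<psi> g (tensor_along T g) (tensor_along T g) a =
       inner_in c d (tensor_in c d) (tensor_in c d) x"
    unfolding a_def g_def by (rule section_inner_in[OF x, where X = "tensor_in c d" and Y = "tensor_in c d", OF \<tau> \<tau>])
  show "section_inner A \<phi> B \<psi> g (differential_section g) (tensor_along T g) a =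
       inner_in c d (differential_in c d) (tensor_in c d) x"
    unfolding a_def g_def by (rule section_inner_in[OF x, where X = "differential_in c d" and Y = "tensor_in c d", OF \<delta> \<tau>])
qed

definition integrand_in :: "real \<times> (real ^ 'm) \<Rightarrow> real" where
  "integrand_in x = inner_in c d (differential_in c d) (differential_in c d) x *
     inner_in c d (tensor_in c d) (tensor_in c d) x /
     (inner_in c d (differential_in c d) (tensor_in c d) x)\<^sup>2"

lemma integrand_in_eq:
  "x \<in> domain_in c d \<Longrightarrow> integrand (fst x) (chart_inv c (snd x)) = integrand_in x"
  by (simp add: integrand_def integrand_in_def section_inner_differential_tensor_in)

lemma nondegenerate_in:
  "x \<in> domain_in c d \<Longrightarrow> inner_in c d (differential_in c d) (tensor_in c d) x \<noteq> 0"
  using F_nondegenerate[OF domain_inD(1)] section_inner_differential_tensor_in(3) by metis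

lemma smooth_tensor_components:
  "smooth_on (coords (product_chart c d) ` chart_dom (product_chart c d))
     (T (product_chart c d) \<circ> chart_inv (product_chart c d))"
  by (rule T(1)[unfolded tensor_field_11_def, THEN conjunct1, rule_format, OF product_atlasI[OF c d]])

lemma continuous_join_map_in: "continuous_on (domain_in c d) (\<lambda>x. join_vec (snd x) (map_in c d x))"
proof -
  have "continuous_on (domain_in c d) (\<lambda>x. (snd x, map_in c d x))"
    by (intro continuous_intros continuous_map_in)
  from bounded_linear.continuous_on[OF bounded_linear_join_vec this]
  have "continuous_on (domain_in c d) (\<lambda>x. join_vec (fst (snd x, map_in c d x)) (snd (snd x, map_in c d x)))" .
  then have "continuous_on (domain_in c d) (\<lambda>x. join_vec (snd x) (map_in c d x))"
    unfolding fst_conv snd_conv .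
  then show ?thesis .
qed

lemma continuous_components_in:
  "continuous_on (domain_in c d) (\<lambda>x. source_metric_inv_in c x $ \<alpha> $ \<beta>)"
  "continuous_on (domain_in c d) (\<lambda>x. target_metric_in c d x $ i $ j)"
  "continuous_on (domain_in c d) (\<lambda>x. differential_in c d x $ i $ \<alpha>)"
  "continuous_on (domain_in c d) (\<lambda>x. tensor_in c d x $ i $ \<alpha>)"
proof -
  have "continuous_on (coords c ` chart_dom c) (\<phi> c \<circ> chart_inv c)"
    by (rule smooth_on_continuous_on[OF riemannian_metric_smooth[OF metric(1) c]])
  then have "continuous_on (domain_in c d) (\<lambda>x. (\<phi> c \<circ> chart_inv c) (snd x))"
    by (rule continuous_on_compose2[OF _ continuous_on_snd[OF continuous_on_id]]) (use domain_inD(2) in blast)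
  moreover have "invertible ((\<phi> c \<circ> chart_inv c) (snd x))" if "x \<in> domain_in c d" for x
    using metric_invertible[OF metric(1) c] domain_inD(3)[OF that] by simp
  ultimately show "continuous_on (domain_in c d) (\<lambda>x. source_metric_inv_in c x $ \<alpha> $ \<beta>)"
    unfolding source_metric_inv_in_def by (rule continuous_on_matrix_inv)
  have "continuous_on (coords d ` chart_dom d) (\<psi> d \<circ> chart_inv d)"
    by (rule smooth_on_continuous_on[OF riemannian_metric_smooth[OF metric(2) d]])
  then have "continuous_on (domain_in c d) (\<lambda>x. (\<psi> d \<circ> chart_inv d) (map_in c d x))"
    by (rule continuous_on_compose2[OF _ continuous_map_in]) (use domain_inD(5) in blast)
  then show "continuous_on (domain_in c d) (\<lambda>x. target_metric_in c d x $ i $ j)"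
    unfolding target_metric_in_def by (intro continuous_on_component)
  show "continuous_on (domain_in c d) (\<lambda>x. differential_in c d x $ i $ \<alpha>)"
    by (simp add: differential_in_def)
      (intro continuous_on_component smooth_on_continuous_on smooth_on_frechet_derivative smooth_map_in)
  have "continuous_on (domain_in c d)
      (\<lambda>x. (T (product_chart c d) \<circ> chart_inv (product_chart c d)) (join_vec (snd x) (map_in c d x)))"
    by (rule continuous_on_compose2[OF smooth_on_continuous_on[OF smooth_tensor_components] continuous_join_map_in])
      (use join_in_image in blast)
  then show "continuous_on (domain_in c d) (\<lambda>x. tensor_in c d x $ i $ \<alpha>)"
    by (simp only: tensor_in_def vec_lambda_beta) (intro continuous_on_component)
qed

lemma
  continuous_inner_in:
    "continuous_on (domain_in c d) (inner_in c d (differential_in c d) (differential_in c d))"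
    "continuous_on (domain_in c d) (inner_in c d (tensor_in c d) (tensor_in c d))"
    "continuous_on (domain_in c d) (inner_in c d (differential_in c d) (tensor_in c d))"
  by (rule continuous_on_mixed_form; rule continuous_components_in)+

lemma nondegenerate_square_in:
  "\<forall>x\<in>domain_in c d. (inner_in c d (differential_in c d) (tensor_in c d) x)\<^sup>2 \<noteq> 0"
proof
  fix x assume "x \<in> domain_in c d"
  from nondegenerate_in[OF this]
  show "(inner_in c d (differential_in c d) (tensor_in c d) x)\<^sup>2 \<noteq> 0"
    by (rule power_not_zero)
qed

lemma continuous_integrand_in: "continuous_on (domain_in c d) integrand_in"
  unfolding integrand_in_def
  by (rule continuous_on_divide[OF continuous_on_mult[OF continuous_inner_in(1,2)]
      continuous_on_power[OF continuous_inner_in(3)] nondegenerate_square_in])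

context
  fixes u0
  assumes u0: "(0, u0) \<in> domain_in c d"
begin

lemma differential_eq_tensor_in:
  assumes "(0, u) \<in> domain_in c d"
  shows "differential_in c d (0, u) = tensor_in c d (0, u)"
  using differential_section_in[OF assms] tensor_along_in[OF assms] domain_inD(3,4)[OF assms]
    pde[unfolded solves_pde_def, rule_format, OF c d, of "chart_inv c u"]
  by (simp add: F0)

text \<open>Both $\delta F_t$ and \<open>T\<close> along $F_t$ change by $O(t)$ as the time runs from \<open>0\<close> to \<open>t\<close>, and at time
  \<open>0\<close> they coincide by the differential equation.\<close>

lemma discrepancy_bigo:
  "(\<lambda>x. (differential_in c d x - tensor_in c d x) $ i $ \<alpha>) \<in> O[nhds (0, u0)](fst)"
proof -
  let ?E = "nhds (0::real, u0)"
  let ?d = "\<lambda>x. differential_in c d x $ i $ \<alpha>" and ?t = "\<lambda>x. tensor_in c d x $ i $ \<alpha>"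
  let ?x0 = "\<lambda>x::real \<times> (real ^ 'm). (0::real, snd x)"
  let ?J = "\<lambda>x. join_vec (snd x) (map_in c d x)"
  let ?T = "T (product_chart c d) \<circ> chart_inv (product_chart c d)"
  have "(\<lambda>x. norm (frechet_derivative (map_in c d) (at x) (0, axis \<alpha> 1)
      - frechet_derivative (map_in c d) (at (?x0 x)) (0, axis \<alpha> 1))) \<in> O[?E](fst)"
    by (rule smooth_time_bigo[OF open_domain_in smooth_on_frechet_derivative[OF smooth_map_in] u0])
  then have d: "(\<lambda>x. ?d x - ?d (?x0 x)) \<in> O[?E](fst)"
  proof (rule landau_o.big_trans[rotated], intro bigoI[where c = 1] always_eventually allI)
    fix x show "norm (?d x - ?d (?x0 x)) \<le> 1 * norm (norm (frechet_derivative (map_in c d) (at x) (0, axis \<alpha> 1)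
      - frechet_derivative (map_in c d) (at (?x0 x)) (0, axis \<alpha> 1)))"
      unfolding differential_in_def using component_le_norm_cart[of "_ - _"] by simp
  qed
  have "(\<lambda>x. norm (?J x - ?J (?x0 x))) \<in> O[?E](fst)"
  proof -
    \<comment> \<open>The coordinates of the source do not depend on the time, so only the second block varies.\<close>
    obtain K where K: "\<And>x. norm (join_vec (fst x) (snd x) :: real ^ ('m + 'n)) \<le> norm x * K"
      using bounded_linear.bounded[OF bounded_linear_join_vec] by blast
    have "norm (?J x - ?J (?x0 x)) \<le> K * norm (map_in c d x - map_in c d (?x0 x))" for x
    proof -
      have "?J x - ?J (?x0 x) = join_vec 0 (map_in c d x - map_in c d (?x0 x))"
        by (auto simp: join_vec_def vec_eq_iff split: sum.split)
      then show ?thesis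
        using K[of "(0, map_in c d x - map_in c d (?x0 x))"] by (simp add: norm_Pair mult.commute)
    qed
    then have "(\<lambda>x. norm (?J x - ?J (?x0 x))) \<in> O[?E](\<lambda>x. norm (map_in c d x - map_in c d (?x0 x)))"
      by (intro bigoI[where c = K]) simp
    then show ?thesis
      using smooth_time_bigo[OF open_domain_in smooth_map_in u0] by (rule landau_o.big_trans)
  qed
  moreover have "isCont ?J (0, u0)"
    using continuous_join_map_in open_domain_in u0 by (simp add: continuous_on_eq_continuous_at)
  moreover have "open (coords (product_chart c d) ` chart_dom (product_chart c d))"
    unfolding product_chart_image by (intro open_join_parts open_chart_image charts)
  ultimately have "(\<lambda>x. norm (?T (?J x) - ?T (?J (?x0 x)))) \<in> O[?E](fst)"
    by (intro smooth_compose_time_bigo[where k = ?T and J = ?J, OF _ smooth_tensor_components join_in_image[OF u0]])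
  then have t: "(\<lambda>x. ?t x - ?t (?x0 x)) \<in> O[?E](fst)"
  proof (rule landau_o.big_trans[rotated], intro bigoI[where c = 1] always_eventually allI)
    fix x
    have "\<bar>(M - M') $ k $ l\<bar> \<le> norm (M - M')" for M M' :: "real ^ ('m + 'n) ^ ('m + 'n)" and k l
      by (rule order_trans[OF component_le_norm_cart Finite_Cartesian_Product.norm_nth_le])
    from this[of "?T (?J x)" "?T (?J (?x0 x))"] show "norm (?t x - ?t (?x0 x)) \<le> 1 * norm (norm (?T (?J x) - ?T (?J (?x0 x))))"
      unfolding tensor_in_def by simp
  qed
  have "isCont ?x0 (0, u0)" by (intro continuous_intros)
  from isCont_tendsto_nhds[OF this] have "filterlim ?x0 ?E ?E" by simp
  then have "\<forall>\<^sub>F x in ?E. ?x0 x \<in> domain_in c d"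
    using u0 open_domain_in by (auto dest: topological_tendstoD)
  then have "\<forall>\<^sub>F x in ?E. (?d x - ?d (?x0 x)) - (?t x - ?t (?x0 x)) =
      (differential_in c d x - tensor_in c d x) $ i $ \<alpha>"
    by eventually_elim (simp add: differential_eq_tensor_in)
  from iffD1[OF landau_o.big.in_cong[OF this] sum_in_bigo(2)[OF d t]] show ?thesis .
qed

text \<open>With $R = \delta F_t - T$ the Cauchy-Schwarz defect turns the integrand minus one into
  $(\|R\|^2 \|T\|^2 - \langle R,T\rangle^2) / \langle\delta F_t,T\rangle^2$. The numerator is $O(t^2)$ and the
  denominator is continuous and does not vanish.\<close>

lemma integrand_in_bigo: "(\<lambda>x. integrand_in x - 1) \<in> O[nhds (0, u0)](\<lambda>x. (fst x)\<^sup>2)"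
proof -
  let ?E = "nhds (0::real, u0)"
  let ?P = "source_metric_inv_in c" and ?G = "target_metric_in c d"
  let ?S = "differential_in c d" and ?T = "tensor_in c d" 
  let ?R = "\<lambda>x. differential_in c d x - tensor_in c d x"
  note one = continuous_on_imp_bigo_1[OF open_domain_in _ u0]
  have RR: "(\<lambda>x. inner_in c d ?R ?R x) \<in> O[?E](\<lambda>x. fst x * fst x)"
    and RT: "(\<lambda>x. inner_in c d ?R ?T x) \<in> O[?E](\<lambda>x. fst x * 1)"
    and TT: "(\<lambda>x. inner_in c d ?T ?T x) \<in> O[?E](\<lambda>x. 1 * 1)"
    by (intro mixed_form_bigo one continuous_components_in discrepancy_bigo)+
  have "(\<lambda>x. inner_in c d ?R ?R x * inner_in c d ?T ?T x - (inner_in c d ?R ?T x)\<^sup>2)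
      \<in> O[?E](\<lambda>x. (fst x)\<^sup>2)"
    using sum_in_bigo(2)[OF landau_o.big.mult[OF RR TT, unfolded mult_1_right]
        landau_o.big.mult[OF RT RT, unfolded mult_1_right]]
    unfolding power2_eq_square .
  moreover have "(\<lambda>x. inverse ((inner_in c d ?S ?T x)\<^sup>2)) \<in> O[?E](\<lambda>_. 1)"
    by (rule one[OF continuous_on_inverse[OF continuous_on_power[OF continuous_inner_in(3)] nondegenerate_square_in]])
  ultimately have *: "(\<lambda>x. (inner_in c d ?R ?R x * inner_in c d ?T ?T x - (inner_in c d ?R ?T x)\<^sup>2)
      * inverse ((inner_in c d ?S ?T x)\<^sup>2)) \<in> O[?E](\<lambda>x. (fst x)\<^sup>2 * 1)"
    by (rule landau_o.big.mult)
  have "\<forall>\<^sub>F x in ?E. x \<in> domain_in c d"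
    by (rule eventually_nhds_in_open[OF open_domain_in u0])
  then have "\<forall>\<^sub>F x in ?E. (inner_in c d ?R ?R x * inner_in c d ?T ?T x - (inner_in c d ?R ?T x)\<^sup>2)
      * inverse ((inner_in c d ?S ?T x)\<^sup>2) = integrand_in x - 1"
  proof eventually_elim
    case (elim x)
    note x = domain_inD[OF elim]
    have P: "transpose (?P x) = ?P x"
      unfolding source_metric_inv_in_def comp_apply
      by (intro transpose_matrix_inv metric_invertible[OF metric(1) c x(3)] riemannian_metric_sym[OF metric(1) c x(3)])
    have G: "transpose (?G x) = ?G x"
      using riemannian_metric_sym[OF metric(2) d x(4)] x(6) by (simp add: target_metric_in_def)
    have "integrand_in x - 1 =
      (inner_in c d ?S ?S x * inner_in c d ?T ?T x - (inner_in c d ?S ?T x)\<^sup>2) * inverse ((inner_in c d ?S ?T x)\<^sup>2)"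
      using nondegenerate_in[OF elim] by (simp add: integrand_in_def field_simps)
    then show ?case by (simp only: cauchy_schwarz_defect[OF P G, of "?S x" "?T x"])
  qed
  from iffD1[OF landau_o.big.in_cong[OF this] *] show ?thesis
    by (simp only: mult_1_right)
qed

end

end

end


section \<open>The first variation\<close>

text \<open>The measure is arbitrary. If the total mass is finite, integration of the bound gives a change
  of $O(t^2)$. If it is infinite, all integrands are at least $1/2$ for small \<open>t\<close> and therefore
  not integrable, so that all the integrals have the default value \<open>0\<close> and the derivative
  is again \<open>0\<close>. The case distinction takes the place of a proof that a compact manifold has
  finite volume.\<close>

lemma integral_stationary:
  fixes h :: "real \<Rightarrow> 'a \<Rightarrow> real"
  assumes meas: "\<forall>\<^sub>F t in nhds 0. h t \<in> borel_measurable \<mu>"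
    and bound: "\<forall>\<^sub>F t in nhds 0. \<forall>x. \<bar>h t x - 1\<bar> \<le> C * t\<^sup>2"
  shows "((\<lambda>t. integral\<^sup>L \<mu> (h t)) has_real_derivative 0) (at 0)"
proof (cases "emeasure \<mu> (space \<mu>) = \<infinity>")
  case True
  have not_integrable: "\<not> integrable \<mu> g" if "\<And>x. g x \<ge> 1 / 2" for g :: "'a \<Rightarrow> real"
  proof
    assume g: "integrable \<mu> g"
    have "norm (1 / 2 :: real) \<le> norm (g x)" for x
      using that[of x] by simp
    then have "integrable \<mu> (\<lambda>x. 1 / 2 :: real)"
      by (intro Bochner_Integration.integrable_bound[OF g] AE_I2) simp_all
    with True show False
      by (simp add: integrable_iff_bounded ennreal_mult_top)
  qed
  have "((\<lambda>t. C * t\<^sup>2) \<longlongrightarrow> C * 0\<^sup>2) (nhds (0::real))"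
    by (intro tendsto_intros filterlim_ident)
  then have "\<forall>\<^sub>F t in nhds 0. C * t\<^sup>2 < 1 / 2"
    by (rule order_tendstoD(2)) simp
  with bound have "\<forall>\<^sub>F t in nhds 0. integral\<^sup>L \<mu> (h t) = 0"
  proof eventually_elim
    case (elim t)
    have "h t x \<ge> 1 / 2" for x
      using elim(1)[rule_format, of x] elim(2) by (simp add: abs_le_iff)
    then show ?case by (intro not_integrable_integral_eq not_integrable)
  qed
  then show ?thesis
    using DERIV_cong_ev[of 0 0 "\<lambda>t. integral\<^sup>L \<mu> (h t)" "\<lambda>_. 0"] by simp
next
  case False
  then interpret finite_measure \<mu> by (rule finite_measureI)
  let ?L = "\<lambda>t. integral\<^sup>L \<mu> (h t)"
  have h0: "h 0 = (\<lambda>_. 1)"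
    using eventually_nhds_x_imp_x[OF bound] by auto
  have "\<forall>\<^sub>F t in nhds 0. norm (?L t - ?L 0) \<le> norm t * (\<bar>C\<bar> * measure \<mu> (space \<mu>) * \<bar>t\<bar>)"
    using meas bound
  proof eventually_elim
    case (elim t)
    have m: "(\<lambda>x. h t x - 1) \<in> borel_measurable \<mu>" using elim(1) by simp
    have i: "integrable \<mu> (\<lambda>x. h t x - 1)"
      by (rule integrable_const_bound[of _ "C * t\<^sup>2"]) (use elim(2) m in auto)
    have "integrable \<mu> (\<lambda>x. (h t x - 1) + 1)"
      by (intro Bochner_Integration.integrable_add i) simp
    then have "integrable \<mu> (h t)" by simp
    then have "?L t - ?L 0 = (\<integral>x. h t x - 1 \<partial>\<mu>)"
      by (simp add: h0)
    also have "norm \<dots> \<le> (\<integral>x. norm (h t x - 1) \<partial>\<mu>)"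
      by (rule integral_norm_bound)
    also have "\<dots> \<le> (\<integral>x. \<bar>C\<bar> * t\<^sup>2 \<partial>\<mu>)"
    proof (rule integral_mono[OF integrable_norm[OF i]])
      fix x
      have "C * t\<^sup>2 \<le> \<bar>C\<bar> * t\<^sup>2" by (rule mult_right_mono) auto
      then show "norm (h t x - 1) \<le> \<bar>C\<bar> * t\<^sup>2"
        using elim(2)[rule_format, of x] by simp
    qed simp
    also have "\<dots> = norm t * (\<bar>C\<bar> * measure \<mu> (space \<mu>) * \<bar>t\<bar>)"
      by (cases "t \<ge> 0") (simp_all add: power2_eq_square ac_simps)
    finally show ?case .
  qed
  then have le: "\<forall>\<^sub>F t in at 0. norm ((?L t - ?L 0) / t) \<le> \<bar>C\<bar> * measure \<mu> (space \<mu>) * \<bar>t\<bar>"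
    unfolding eventually_at_filter
    by eventually_elim (auto simp: divide_le_eq mult.commute)
  have "((\<lambda>t. \<bar>C\<bar> * measure \<mu> (space \<mu>) * \<bar>t\<bar>) \<longlongrightarrow> \<bar>C\<bar> * measure \<mu> (space \<mu>) * \<bar>0\<bar>) (at (0::real))"
    by (intro tendsto_intros)
  then have "((\<lambda>t. (?L t - ?L 0) / t) \<longlongrightarrow> 0) (at 0)"
    by (intro Lim_null_comparison[OF le]) simp
  then show ?thesis by (simp add: DERIV_def)
qed

lemma sets_riemannian_volume: "sets (riemannian_volume A g) = sets borel"
  unfolding riemannian_volume_def by (subst sets_measure_of) (auto simp: sets.sigma_sets_eq[of borel, simplified])

context pde_variation
begin

lemma continuous_integrand:
  assumes t: "t \<in> {-\<epsilon><..<\<epsilon>}"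
  shows "continuous_on UNIV (integrand t)"
proof (rule continuous_at_imp_continuous_on, rule ballI)
  fix a0
  define c d where "c = chart_at A a0" and "d = chart_at B (F t a0)"
  note c = chart_at[OF atlas(1), of a0, folded c_def] and d = chart_at[OF atlas(2), of "F t a0", folded d_def]
  note charts = atlas_chart[OF atlas(1) c(1)] atlas_chart[OF atlas(2) d(1)]
  let ?U = "chart_dom c \<inter> F t -` chart_dom d"
  have "continuous_on UNIV (F t)" using F_smooth[OF t] by (simp add: smooth_maps_def)
  then have U: "open ?U" by (intro open_Int open_chart_dom charts open_vimage)
  have p: "(t, coords c p) \<in> domain_in c d" if "p \<in> ?U" for p
    using that t by (intro domain_inI[OF c(1) d(1)]) auto
  have "continuous_on ?U (\<lambda>p. (t, coords c p))"
    by (intro continuous_intros continuous_on_subset[OF continuous_on_coords[OF charts(1)]]) simp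
  then have "continuous_on ?U (\<lambda>p. integrand_in c d (t, coords c p))"
    by (rule continuous_on_compose2[OF continuous_integrand_in[OF c(1) d(1)]]) (use p in blast)
  then have "continuous_on ?U (integrand t)"
  proof (rule continuous_on_eq)
    fix q assume q: "q \<in> ?U"
    show "integrand_in c d (t, coords c q) = integrand t q"
      using integrand_in_eq[OF c(1) d(1) p[OF q]] chart_inv_coords[OF charts(1), of q] q by simp
  qed
  then show "isCont (integrand t) a0"
    using continuous_on_eq_continuous_at[OF U] c(2) d(2) by blast
qed

lemma integrand_local_bound:
  "\<exists>C U. open U \<and> a0 \<in> U \<and> (\<forall>\<^sub>F t in nhds 0. \<forall>p\<in>U. \<bar>integrand t p - 1\<bar> \<le> C * t\<^sup>2)"
proof -
  define c d where "c = chart_at A a0" and "d = chart_at B (f a0)"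
  note c = chart_at[OF atlas(1), of a0, folded c_def] and d = chart_at[OF atlas(2), of "f a0", folded d_def]
  note charts = atlas_chart[OF atlas(1) c(1)] atlas_chart[OF atlas(2) d(1)]
  let ?u0 = "coords c a0"
  have u0: "(0, ?u0) \<in> domain_in c d"
    using domain_inI[OF c(1) d(1), of 0 a0] c(2) d(2) \<epsilon> by (simp add: F0)
  obtain C where "\<forall>\<^sub>F x in nhds (0, ?u0). norm (integrand_in c d x - 1) \<le> C * norm ((fst x)\<^sup>2)"
    using landau_o.bigE[OF integrand_in_bigo[OF c(1) d(1) u0]] by blast
  with eventually_nhds_in_open[OF open_domain_in[OF c(1) d(1)] u0]
  have "\<forall>\<^sub>F x in nhds (0, ?u0). x \<in> domain_in c d \<and> \<bar>integrand_in c d x - 1\<bar> \<le> C * (fst x)\<^sup>2"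
    by eventually_elim simp
  then obtain P Q where P: "eventually P (nhds 0)" and Q: "eventually Q (nhds ?u0)"
    and PQ: "\<And>t u. P t \<Longrightarrow> Q u \<Longrightarrow> (t, u) \<in> domain_in c d \<and> \<bar>integrand_in c d (t, u) - 1\<bar> \<le> C * t\<^sup>2"
    unfolding nhds_prod eventually_prod_filter fst_conv by blast
  obtain V where V: "open V" "?u0 \<in> V" "\<And>u. u \<in> V \<Longrightarrow> Q u"
    using Q unfolding eventually_nhds by blast
  let ?U = "chart_dom c \<inter> coords c -` V"
  have "open ?U"
    by (rule continuous_open_preimage[OF continuous_on_coords open_chart_dom V(1)]) (rule charts)+
  moreover have "a0 \<in> ?U" using c(2) V(2) by simp
  moreover have "\<forall>\<^sub>F t in nhds 0. \<forall>p\<in>?U. \<bar>integrand t p - 1\<bar> \<le> C * t\<^sup>2"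
    using P
  proof eventually_elim
    case (elim t)
    show ?case
    proof
      fix p assume p: "p \<in> ?U"
      with PQ[OF elim V(3), of "coords c p"]
      have x: "(t, coords c p) \<in> domain_in c d" "\<bar>integrand_in c d (t, coords c p) - 1\<bar> \<le> C * t\<^sup>2"
        by simp_all
      then show "\<bar>integrand t p - 1\<bar> \<le> C * t\<^sup>2"
        using integrand_in_eq[OF c(1) d(1) x(1)] chart_inv_coords[OF charts(1), of p] p by simp
    qed
  qed
  ultimately show ?thesis by blast
qed

text \<open>Finitely many of the neighbourhoods from the local bound cover the manifold; the sum of their
  constants is a common one.\<close>

lemma integrand_uniform_bound:
  assumes "compact (UNIV :: 'p set)"
  obtains C where "\<forall>\<^sub>F t in nhds 0. \<forall>p. \<bar>integrand t p - 1\<bar> \<le> C * t\<^sup>2"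
proof -
  let ?bounded = "\<lambda>C U. \<forall>\<^sub>F t in nhds 0. \<forall>p\<in>U. \<bar>integrand t p - 1\<bar> \<le> C * t\<^sup>2"
  let ?\<U> = "{U. open U \<and> (\<exists>C. ?bounded C U)}"
  have "UNIV \<subseteq> \<Union>?\<U>"
  proof
    fix a
    obtain C U where "open U" "a \<in> U" "?bounded C U"
      using integrand_local_bound[of a] by (elim exE conjE)
    then show "a \<in> \<Union>?\<U>" by (intro UnionI[of U]) auto
  qed
  then obtain S where S: "S \<subseteq> ?\<U>" "finite S" "UNIV \<subseteq> \<Union>S"
    by (rule compactE[OF assms]) simp_all
  have "\<forall>U\<in>S. \<exists>C. ?bounded C U" using S(1) by auto
  from bchoice[OF this] obtain C where C: "\<And>U. U \<in> S \<Longrightarrow> ?bounded (C U) U" by auto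
  have "\<forall>\<^sub>F t in nhds 0. \<forall>U\<in>S. \<forall>p\<in>U. \<bar>integrand t p - 1\<bar> \<le> C U * t\<^sup>2"
    by (intro eventually_ball_finite S(2) ballI C)
  then have "\<forall>\<^sub>F t in nhds 0. \<forall>p. \<bar>integrand t p - 1\<bar> \<le> (\<Sum>U\<in>S. \<bar>C U\<bar>) * t\<^sup>2"
  proof eventually_elim
    case (elim t)
    show ?case
    proof
      fix p
      obtain U where U: "U \<in> S" "p \<in> U" using S(3) by blast
      have "C U \<le> (\<Sum>U\<in>S. \<bar>C U\<bar>)"
        using member_le_sum[OF U(1), of "\<lambda>U. \<bar>C U\<bar>"] S(2) by simp
      then have "C U * t\<^sup>2 \<le> (\<Sum>U\<in>S. \<bar>C U\<bar>) * t\<^sup>2"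
        by (rule mult_right_mono) simp
      then show "\<bar>integrand t p - 1\<bar> \<le> (\<Sum>U\<in>S. \<bar>C U\<bar>) * t\<^sup>2"
        using elim U by (meson order_trans)
    qed
  qed
  then show ?thesis by (rule that)
qed

lemma first_variation_zero:
  assumes "compact (UNIV :: 'p set)"
  shows "((\<lambda>t. functional_L A \<phi> B \<psi> T (F t)) has_real_derivative 0) (at 0)"
proof -
  obtain C where C: "\<forall>\<^sub>F t in nhds 0. \<forall>p. \<bar>integrand t p - 1\<bar> \<le> C * t\<^sup>2"
    using integrand_uniform_bound[OF assms] .
  have "\<forall>\<^sub>F t in nhds 0. t \<in> {-\<epsilon><..<\<epsilon>}"
    using \<epsilon> by (intro eventually_nhds_in_open) auto
  then have "\<forall>\<^sub>F t in nhds 0. integrand t \<in> borel_measurable (riemannian_volume A \<phi>)"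
  proof eventually_elim
    case (elim t)
    from borel_measurable_continuous_onI[OF continuous_integrand[OF elim]]
    show ?case by (simp add: measurable_cong_sets[OF sets_riemannian_volume refl])
  qed
  from DERIV_cmult[OF integral_stationary[OF this C], of "1 / 2"]
  show ?thesis
    by (simp add: functional_L_def Let_def integrand_def[abs_def])
qed

end

theorem mainTheorem2:
  fixes A :: "('p::{t2_space, second_countable_topology}, 'm::finite) chart set"
    and \<phi> :: "('p, 'm) chart \<Rightarrow> 'p \<Rightarrow> real ^ 'm ^ 'm"
    and B :: "('q::{t2_space, second_countable_topology}, 'n::finite) chart set"
    and \<psi> :: "('q, 'n) chart \<Rightarrow> 'q \<Rightarrow> real ^ 'n ^ 'n"
    and T :: "('p \<times> 'q, 'm + 'n) chart \<Rightarrow> 'p \<times> 'q \<Rightarrow> real ^ ('m + 'n) ^ ('m + 'n)"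
    and f :: "'p \<Rightarrow> 'q"
  assumes "riemannian_manifold A \<phi>"
    and "connected (UNIV :: 'p set)" and "compact (UNIV :: 'p set)" and "orientable A"
    and "riemannian_manifold B \<psi>"
    and "tensor_field_11 (product_atlas A B) T" and "only_mixed_components A B T"
    and "f \<in> smooth_maps A B"
    and "solves_pde A B T f"
    and "\<And>a. section_inner A \<phi> B \<psi> f (differential_section f) (tensor_along T f) a \<noteq> 0"
  shows "critical_point A B (functional_domain A \<phi> B \<psi> T) (functional_L A \<phi> B \<psi> T) f"
  unfolding critical_point_def
proof (intro conjI allI impI)
  show "f \<in> functional_domain A \<phi> B \<psi> T"
    using assms(8,10) by (simp add: functional_domain_def)
next
  fix \<epsilon> F
  assume "smooth_variation A B f \<epsilon> F \<and> (\<forall>t\<in>{-\<epsilon><..<\<epsilon>}. F t \<in> functional_domain A \<phi> B \<psi> T)"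
  then interpret pde_variation A \<phi> B \<psi> T f \<epsilon> F
    using assms(1,5,6,7,9) by unfold_locales blast+
  show "((\<lambda>t. functional_L A \<phi> B \<psi> T (F t)) has_real_derivative 0) (at 0)"
    by (rule first_variation_zero[OF assms(3)])
qed

end
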